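(* Let $\mathcal{M}$ be a von Neumann algebra acting on a separable complex Hilbert space and let $\mathcal{A}\subseteq\mathcal{M}$ be a norm closed unital subalgebra that is logmodular in $\mathcal{M}$. Then $\mathrm{Lat}_{\mathcal{M}}\mathcal{A}$ is a commutative subspace lattice, i.e. $pq=qp$ for all $p,q\in\mathrm{Lat}_{\mathcal{M}}\mathcal{A}$. Moreover, if $\mathcal{M}$ is a factor, then $\mathrm{Lat}_{\mathcal{M}}\mathcal{A}$ is a nest, i.e. for all $p,q\in\mathrm{Lat}_{\mathcal{M}}\mathcal{A}$ either $p\le q$ or $q\le p$.
   Context: Subalgebras are not assumed self-adjoint; they contain the identity $1$ of $\mathcal{M}$. Projections are orthogonal projections. $\mathcal{A}^{-1}=\{a\in\mathcal{A}: a \text{ is invertible and } a^{-1}\in\mathcal{A}\}$, and $\mathcal{M}_+^{-1}$ is the set of positive invertible elements of $\mathcal{M}$. $\mathcal{A}$ is logmodular in $\mathcal{M}$ if $\{a^*a: a\in\mathcal{A}^{-1}\}$ is norm dense in $\mathcal{M}_+^{-1}$. $\mathrm{Lat}_{\mathcal{M}}\mathcal{A}=\{p\in\mathcal{M}: p=p^2=p^*,\ ap=pap\ \forall a\in\mathcal{A}\}$. A factor is a von Neumann algebra with trivial center. *)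

theory Defs
  imports "HOL-Analysis.Analysis"
begin

section \<open>Complex Hilbert spaces\<close>

class complex_vector = real_vector +
  fixes scaleC :: "complex \<Rightarrow> 'a \<Rightarrow> 'a"  (infixr \<open>*\<^sub>C\<close> 75)
  assumes scaleC_add_right: "c *\<^sub>C (x + y) = c *\<^sub>C x + c *\<^sub>C y"
    and scaleC_add_left: "(c + d) *\<^sub>C x = c *\<^sub>C x + d *\<^sub>C x"
    and scaleC_scaleC: "c *\<^sub>C (d *\<^sub>C x) = (c * d) *\<^sub>C x"
    and scaleC_one: "1 *\<^sub>C x = x"
    and scaleR_scaleC: "r *\<^sub>R x = complex_of_real r *\<^sub>C x"

text \<open>The complex inner product is conjugate linear in the first argument. The real inner product
  of the superclass is its real part, so that the norm is the Hilbert space norm and definiteness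
  of \<open>cinner\<close> is inherited (\<open>cinner x x\<close> is real by conjugate symmetry).\<close>

class complex_inner = complex_vector + real_inner +
  fixes cinner :: "'a \<Rightarrow> 'a \<Rightarrow> complex"
  assumes cinner_commute: "cinner x y = cnj (cinner y x)"
    and cinner_add_right: "cinner x (y + z) = cinner x y + cinner x z"
    and cinner_scaleC_right: "cinner x (c *\<^sub>C y) = c * cinner x y"
    and inner_eq_Re_cinner: "inner x y = Re (cinner x y)"

class chilbert_space = complex_inner + complete_space

lemma norm_scaleC: "norm (c *\<^sub>C x) = cmod c * norm (x :: 'a :: complex_inner)"
proof -
  have "cinner (c *\<^sub>C x) (c *\<^sub>C x) = c * cnj (cinner x (c *\<^sub>C x))"
    by (metis cinner_commute cinner_scaleC_right)
  also have "\<dots> = c * cnj c * cinner x x"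
    by (metis cinner_commute cinner_scaleC_right complex_cnj_mult mult.assoc)
  also have "\<dots> = complex_of_real ((cmod c)\<^sup>2) * cinner x x"
    by (simp only: complex_norm_square)
  finally have "inner (c *\<^sub>C x) (c *\<^sub>C x) = (cmod c)\<^sup>2 * inner x x"
    by (simp add: inner_eq_Re_cinner)
  then show ?thesis
    by (simp add: norm_eq_sqrt_inner real_sqrt_mult)
qed

lemma bounded_linear_scaleC: "bounded_linear (\<lambda>x :: 'a :: complex_inner. c *\<^sub>C x)"
  by (rule bounded_linear_intro[where K = "cmod c"])
    (simp_all add: scaleC_add_right scaleR_scaleC scaleC_scaleC norm_scaleC mult.commute)

instantiation blinfun :: (real_normed_vector, complex_inner) complex_vector
begin

lift_definition scaleC_blinfun :: "complex \<Rightarrow> ('a \<Rightarrow>\<^sub>L 'b) \<Rightarrow> ('a \<Rightarrow>\<^sub>L 'b)"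
  is "\<lambda>c f x. c *\<^sub>C f x"
  by (rule bounded_linear_compose[OF bounded_linear_scaleC])

instance
  by standard
    (transfer; simp add: fun_eq_iff scaleC_add_right scaleC_add_left scaleC_scaleC scaleC_one
      scaleR_scaleC)+

end

section \<open>Operators\<close>

text \<open>\<open>'a \<Rightarrow>\<^sub>L 'a\<close> consists of the bounded \<^emph>\<open>real\<close> linear operators; the complex linear ones
  form the algebra of bounded operators on the Hilbert space, with the operator norm.\<close>

definition bounded_ops :: "('a :: complex_inner \<Rightarrow>\<^sub>L 'a) set" where
  "bounded_ops = {T. \<forall>c x. blinfun_apply T (c *\<^sub>C x) = c *\<^sub>C blinfun_apply T x}"

text \<open>Only meaningful for members of \<open>bounded_ops\<close> over a Hilbert space, where the adjoint exists
  and is unique.\<close>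

definition adj :: "('a :: complex_inner \<Rightarrow>\<^sub>L 'a) \<Rightarrow> ('a \<Rightarrow>\<^sub>L 'a)" where
  "adj T = (THE S. \<forall>x y. cinner (blinfun_apply S x) y = cinner x (blinfun_apply T y))"

definition positive_op :: "('a :: complex_inner \<Rightarrow>\<^sub>L 'a) \<Rightarrow> bool" where
  "positive_op T \<longleftrightarrow> T \<in> bounded_ops \<and> (\<forall>x. cinner x (blinfun_apply T x) \<in> \<real>\<^sub>\<ge>\<^sub>0)"

definition op_le :: "('a :: complex_inner \<Rightarrow>\<^sub>L 'a) \<Rightarrow> ('a \<Rightarrow>\<^sub>L 'a) \<Rightarrow> bool" where
  "op_le S T \<longleftrightarrow> positive_op (T - S)"

section \<open>Operator algebras\<close>

definition unital_subalgebra :: "('a :: complex_inner \<Rightarrow>\<^sub>L 'a) set \<Rightarrow> bool" where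
  "unital_subalgebra A \<longleftrightarrow> A \<subseteq> bounded_ops \<and> id_blinfun \<in> A \<and>
     (\<forall>S\<in>A. \<forall>T\<in>A. S + T \<in> A) \<and> (\<forall>c. \<forall>T\<in>A. c *\<^sub>C T \<in> A) \<and> (\<forall>S\<in>A. \<forall>T\<in>A. S o\<^sub>L T \<in> A)"

definition commutant :: "('a :: complex_inner \<Rightarrow>\<^sub>L 'a) set \<Rightarrow> ('a \<Rightarrow>\<^sub>L 'a) set" where
  "commutant S = {T \<in> bounded_ops. \<forall>s\<in>S. T o\<^sub>L s = s o\<^sub>L T}"

definition von_neumann_algebra :: "('a :: chilbert_space \<Rightarrow>\<^sub>L 'a) set \<Rightarrow> bool" where
  "von_neumann_algebra M \<longleftrightarrow> unital_subalgebra M \<and> (\<forall>T\<in>M. adj T \<in> M) \<and>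
     commutant (commutant M) = M"

definition center :: "('a :: complex_inner \<Rightarrow>\<^sub>L 'a) set \<Rightarrow> ('a \<Rightarrow>\<^sub>L 'a) set" where
  "center M = {T \<in> M. \<forall>S\<in>M. T o\<^sub>L S = S o\<^sub>L T}"

definition is_factor :: "('a :: chilbert_space \<Rightarrow>\<^sub>L 'a) set \<Rightarrow> bool" where
  "is_factor M \<longleftrightarrow> von_neumann_algebra M \<and> center M = {c *\<^sub>C id_blinfun | c. True}"

definition invertibles :: "('a :: complex_inner \<Rightarrow>\<^sub>L 'a) set \<Rightarrow> ('a \<Rightarrow>\<^sub>L 'a) set" where
  "invertibles A = {a \<in> A. \<exists>b\<in>A. a o\<^sub>L b = id_blinfun \<and> b o\<^sub>L a = id_blinfun}"

definition positive_invertibles :: "('a :: complex_inner \<Rightarrow>\<^sub>L 'a) set \<Rightarrow> ('a \<Rightarrow>\<^sub>L 'a) set" where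
  "positive_invertibles M = {T \<in> invertibles M. positive_op T}"

text \<open>For a subalgebra \<open>A\<close> of a von Neumann algebra \<open>M\<close> the elements \<open>a\<^sup>*a\<close> belong to
  \<open>positive_invertibles M\<close>, so this inclusion is density in that set.\<close>

definition logmodular :: "('a :: chilbert_space \<Rightarrow>\<^sub>L 'a) set \<Rightarrow> ('a \<Rightarrow>\<^sub>L 'a) set \<Rightarrow> bool" where
  "logmodular M A \<longleftrightarrow> positive_invertibles M \<subseteq> closure {adj a o\<^sub>L a | a. a \<in> invertibles A}"

definition Lat :: "('a :: complex_inner \<Rightarrow>\<^sub>L 'a) set \<Rightarrow> ('a \<Rightarrow>\<^sub>L 'a) set \<Rightarrow> ('a \<Rightarrow>\<^sub>L 'a) set" where
  "Lat M A = {p \<in> M. p o\<^sub>L p = p \<and> adj p = p \<and> (\<forall>a\<in>A. a o\<^sub>L p = p o\<^sub>L a o\<^sub>L p)}"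

end

theory Submission
  imports Defs
begin

text \<open>
  Let \<open>z\<close> be invertible in \<open>M\<close>. Logmodularity approximates \<open>z\<^sup>* z\<close> by \<open>a\<^sup>* a\<close> with \<open>a\<close> invertible
  in \<open>A\<close>, so \<open>a\<close> is almost an isometry from the Hilbert space with the inner product
  \<open>\<langle>z v, z w\<rangle>\<close> to the original one (\<open>ex_bounded_almost_isometry\<close>). Both \<open>a\<close> and its inverse leave
  the range of every \<open>p \<in> Lat M A\<close> invariant. Hence the relative position of the ranges of
  \<open>p, q \<in> Lat M A\<close>, as far as it is visible in approximate inner products, is the same for all inner
  products \<open>\<langle>z v, z w\<rangle>\<close>. The proof changes this position by a choice of \<open>z\<close> unless \<open>p\<close> and \<open>q\<close> are
  as claimed.

  Commutation. The relative position is measured by the spectrum of \<open>S = q p q\<close> on the range of \<open>q\<close>,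
  that is, by the squared cosines of the angles between the ranges. Given \<open>\<theta>\<close> strictly between \<open>0\<close>
  and \<open>1\<close>, take the spectral subspace \<open>K\<close> of \<open>S\<close> for an interval around \<open>\<theta>\<close>, and stretch
  \<open>(1 - p) K\<close>: this increases the angles that belong to \<open>K\<close> and leaves the others alone, so \<open>\<theta>\<close> is not
  in the spectrum for the new inner product. By invariance it was not in the spectrum before
  (\<open>compression_minus_scalar_bounded_below\<close>). So the spectrum of \<open>S\<close> lies in \<open>{0, 1}\<close>, \<open>S\<close> is a
  projection, and \<open>p\<close> and \<open>q\<close> commute (\<open>projections_commute_if_no_intermediate_spectrum\<close>). The use of a
  von Neumann algebra is that the projection onto \<open>(1 - p) K\<close> belongs to \<open>M\<close>: the subspace is
  invariant under the commutant of \<open>M\<close>. Here \<open>K\<close> is obtained directly, as a set of vectors with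
  bounded orbits under \<open>(S - \<theta>) / \<eta>\<close> (\<open>norm_le_on_orthogonal_complement\<close>).

  Factors. If \<open>p - p q\<close> and \<open>q - q p\<close> are both nonzero, a factor contains a nonzero
  \<open>x = (p - p q) x (q - q p)\<close>. With \<open>z = 1 + x\<close> the parts of the two ranges that are orthogonal to
  their intersection are no longer orthogonal to each other, while in the original inner product
  they are, because \<open>p\<close> and \<open>q\<close> commute; this contradicts the invariance
  (\<open>corner_between_Lat_eq_zero\<close>).
\<close>

section \<open>Closed convex sets and orthogonal projections\<close>

text \<open>This replaces weak compactness of bounded closed convex sets. Nearly norm-minimal points of the
  sets form a Cauchy sequence by the parallelogram law: the midpoint of two of them lies in the
  larger set, so it is not shorter than the infimum of the norm there, and these infima converge.\<close>

lemma nested_closed_convex_nonempty: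
  fixes F :: "nat \<Rightarrow> 'a :: {real_inner, complete_space} set"
  assumes cl: "\<And>n. closed (F n)" and cv: "\<And>n. convex (F n)" and ne: "\<And>n. F n \<noteq> {}"
    and dec: "decseq F" and bd: "\<And>x. x \<in> F 0 \<Longrightarrow> norm x \<le> B"
  shows "\<exists>x. \<forall>n. x \<in> F n"
proof -
  define d where "d n = Inf (norm ` F n)" for n
  define D where "D = (SUP n. d n)"
  have bb: "bdd_below (norm ` F n)" for n
    by (rule bdd_belowI[where m = 0]) auto
  have d_le: "d n \<le> norm x" if "x \<in> F n" for n x
    unfolding d_def using that bb by (intro cInf_lower) auto
  have d0: "0 \<le> d n" for n
    unfolding d_def using ne by (intro cInf_greatest) auto
  have sub: "F m \<subseteq> F n" if "n \<le> m" for n m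
    using dec that by (auto simp: decseq_def)
  have inc: "incseq d"
    unfolding incseq_def
  proof (intro allI impI)
    show "d n \<le> d m" if "n \<le> m" for n m
      unfolding d_def[of m]
      by (rule cInf_greatest) (use ne[of m] d_le sub[OF that] in blast)+
  qed
  have dB: "d n \<le> B" for n
    using ne[of n] d_le[of _ n] sub[of 0 n] bd by fastforce
  have bda: "bdd_above (range d)"
    using dB by (intro bdd_aboveI[where M = B]) auto
  have dD: "d n \<le> D" for n
    unfolding D_def by (rule cSUP_upper[OF _ bda]) simp
  have lim: "d \<longlonglongrightarrow> D"
    unfolding D_def by (rule LIMSEQ_incseq_SUP[OF bda inc])
  have "\<exists>x\<in>F n. norm x < d n + inverse (real (Suc n))" for n
    using cInf_lessD[of "norm ` F n" "d n + inverse (real (Suc n))"] ne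
    by (auto simp: d_def)
  then obtain x where xF: "\<And>n. x n \<in> F n"
    and xd: "\<And>n. norm (x n) < d n + inverse (real (Suc n))"
    by metis
  have est: "(norm (x m - x n))\<^sup>2 \<le> 4 * (D + inverse (real (Suc n)))\<^sup>2 - 4 * (d n)\<^sup>2"
    if "n \<le> m" for n m
  proof -
    have "(1/2) *\<^sub>R x n + (1/2) *\<^sub>R x m \<in> F n"
      using cv[of n] xF[of n] xF[of m] sub[OF that] by (intro convexD) auto
    then have "d n \<le> norm ((1/2) *\<^sub>R (x n + x m))"
      using d_le by (simp add: scaleR_right_distrib)
    then have "2 * d n \<le> norm (x n + x m)" by simp
    then have mid: "4 * (d n)\<^sup>2 \<le> (norm (x n + x m))\<^sup>2"
      using power_mono[of "2 * d n" "norm (x n + x m)" 2] d0[of n]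
      by (simp add: power_mult_distrib)
    have "inverse (real (Suc m)) \<le> inverse (real (Suc n))"
      using that by (intro le_imp_inverse_le) auto
    then have "norm (x m) \<le> D + inverse (real (Suc n))" "norm (x n) \<le> D + inverse (real (Suc n))"
      using xd[of m] xd[of n] dD[of m] dD[of n] by linarith+
    then have "(norm (x m))\<^sup>2 \<le> (D + inverse (real (Suc n)))\<^sup>2"
        "(norm (x n))\<^sup>2 \<le> (D + inverse (real (Suc n)))\<^sup>2"
      by (auto intro: power_mono)
    moreover have "(norm (x m - x n))\<^sup>2 = 2 * (norm (x m))\<^sup>2 + 2 * (norm (x n))\<^sup>2 - (norm (x n + x m))\<^sup>2"
      by (simp add: power2_norm_eq_inner inner_add_left inner_add_right inner_diff_left
          inner_diff_right inner_commute)
    ultimately show ?thesis using mid by linarith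
  qed
  have "(\<lambda>n. 4 * (D + inverse (real (Suc n)))\<^sup>2 - 4 * (d n)\<^sup>2) \<longlonglongrightarrow> 4 * (D + 0)\<^sup>2 - 4 * D\<^sup>2"
    by (intro tendsto_intros lim LIMSEQ_inverse_real_of_nat)
  then have lim0: "(\<lambda>n. 4 * (D + inverse (real (Suc n)))\<^sup>2 - 4 * (d n)\<^sup>2) \<longlonglongrightarrow> 0" by simp
  have "Cauchy x"
    unfolding Cauchy_altdef2
  proof (intro allI impI)
    fix e :: real assume e: "0 < e"
    then have "0 < e\<^sup>2" by simp
    from order_tendstoD(2)[OF lim0 this]
    obtain N where N: "4 * (D + inverse (real (Suc N)))\<^sup>2 - 4 * (d N)\<^sup>2 < e\<^sup>2"
      unfolding eventually_sequentially by blast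
    have "dist (x n) (x N) < e" if "N \<le> n" for n
    proof -
      have "(norm (x n - x N))\<^sup>2 < e\<^sup>2" using est[OF that] N by linarith
      then show ?thesis unfolding dist_norm using e by (auto intro: power2_less_imp_less)
    qed
    then show "\<exists>N. \<forall>n\<ge>N. dist (x n) (x N) < e" by blast
  qed
  then obtain l where l: "x \<longlonglongrightarrow> l"
    using Cauchy_convergent convergent_def by blast
  have "l \<in> F n" for n
  proof (rule closed_sequentially[OF cl])
    show "x (k + n) \<in> F n" for k using xF sub[of n "k + n"] by auto
    show "(\<lambda>k. x (k + n)) \<longlonglongrightarrow> l" using l by (rule LIMSEQ_ignore_initial_segment)
  qed
  then show ?thesis by blast
qed

text \<open>The points of \<open>K\<close> whose distance from \<open>x\<close> is almost minimal form nested closed convex sets.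
  Their common point \<open>y\<close> is nearest to \<open>x\<close>, and comparing it with \<open>y + t k\<close> gives orthogonality.\<close>

lemma ex_orthogonal_component:
  fixes K :: "'a :: {real_inner, complete_space} set"
  assumes cl: "closed K" and sub: "subspace K"
  shows "\<exists>y\<in>K. \<forall>k\<in>K. inner (x - y) k = 0"
proof -
  define F where "F n = (K \<inter> cball x (infdist x K + inverse (real (Suc n))))" for n
  have ne: "K \<noteq> {}" using sub subspace_0 by blast
  have "\<exists>y. \<forall>n. y \<in> F n"
  proof (rule nested_closed_convex_nonempty)
    show "closed (F n)" for n unfolding F_def using cl by auto
    show "convex (F n)" for n
      unfolding F_def using sub by (intro convex_Int convex_cball subspace_imp_convex)
    show "F n \<noteq> {}" for n
    proof -
      have "\<exists>y\<in>K. dist x y < infdist x K + inverse (real (Suc n))"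
        using cInf_lessD[of "dist x ` K" "infdist x K + inverse (real (Suc n))"] ne
        by (auto simp: infdist_def)
      then show ?thesis unfolding F_def by (auto intro: less_imp_le)
    qed
    show "decseq F"
    proof (rule decseq_SucI)
      show "F (Suc n) \<subseteq> F n" for n
      proof -
        have "inverse (real (Suc (Suc n))) \<le> inverse (real (Suc n))"
          by (rule le_imp_inverse_le) auto
        then show ?thesis unfolding F_def by (intro Int_mono subset_cball) auto
      qed
    qed
    show "norm y \<le> norm x + (infdist x K + 1)" if "y \<in> F 0" for y
      using that norm_triangle_sub[of y x] by (simp add: F_def dist_norm norm_minus_commute)
  qed
  then obtain y where y: "\<And>n. y \<in> F n" by blast
  have yK: "y \<in> K" using y[of 0] by (simp add: F_def)
  have "(\<lambda>n. infdist x K + inverse (real (Suc n))) \<longlonglongrightarrow> infdist x K + 0"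
    by (intro tendsto_intros LIMSEQ_inverse_real_of_nat)
  then have "dist x y \<le> infdist x K + 0"
    by (rule LIMSEQ_le_const) (use y in \<open>auto simp: F_def\<close>)
  then have min: "dist x y \<le> dist x k" if "k \<in> K" for k
    using infdist_le[OF that, of x] by linarith
  have "inner (x - y) k = 0" if k: "k \<in> K" for k
  proof -
    define t where "t = inner (x - y) k / inner k k"
    have "y + t *\<^sub>R k \<in> K" using sub yK k by (simp add: subspace_add subspace_scale)
    then have "(norm (x - y))\<^sup>2 \<le> (norm (x - (y + t *\<^sub>R k)))\<^sup>2"
      using min by (intro power_mono) (auto simp: dist_norm)
    also have "\<dots> = (norm (x - y))\<^sup>2 - 2 * t * inner (x - y) k + t * t * inner k k"
      by (simp add: power2_norm_eq_inner inner_add_left inner_add_right inner_diff_left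
          inner_diff_right inner_commute algebra_simps)
    finally have "2 * t * inner (x - y) k \<le> t * t * inner k k" by simp
    then have "2 * (inner (x - y) k)\<^sup>2 \<le> (inner (x - y) k)\<^sup>2" if "k \<noteq> 0"
      using that by (simp add: t_def power2_eq_square divide_simps mult_ac split: if_splits)
    then show ?thesis by (cases "k = 0") auto
  qed
  then show ?thesis using yK by blast
qed

lemma inner_eqI: "(\<And>y. inner u y = inner v y) \<Longrightarrow> u = v"
  using vector_eq_rdot[of u v] by blast

definition orth_proj_onto :: "('a :: real_inner \<Rightarrow>\<^sub>L 'a) \<Rightarrow> 'a set \<Rightarrow> bool" where
  "orth_proj_onto P K \<longleftrightarrow>
     (\<forall>x. P x \<in> K) \<and> (\<forall>x\<in>K. P x = x) \<and> (\<forall>x y. inner (P x) y = inner x (P y))"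

lemma orth_proj_ontoD:
  assumes "orth_proj_onto P K"
  shows "P x \<in> K" "x \<in> K \<Longrightarrow> P x = x" "P (P x) = P x" "inner (P x) y = inner x (P y)"
    and "k \<in> K \<Longrightarrow> inner (x - P x) k = 0"
  using assms unfolding orth_proj_onto_def by (auto simp: inner_diff_left)

lemma ex_orth_proj_onto:
  fixes K :: "'a :: {real_inner, complete_space} set"
  assumes cl: "closed K" and sub: "subspace K"
  shows "\<exists>P. orth_proj_onto P K"
proof -
  obtain f where fK: "\<And>x. f x \<in> K" and fo: "\<And>x k. k \<in> K \<Longrightarrow> inner (x - f x) k = 0"
    using ex_orthogonal_component[OF assms] by metis
  have uniq: "y = f x" if "y \<in> K" "\<And>k. k \<in> K \<Longrightarrow> inner (x - y) k = 0" for x y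
  proof -
    have "f x - y \<in> K" using fK that sub by (simp add: subspace_diff)
    then have "inner (f x - y) (f x - y) = 0"
      using that(2)[of "f x - y"] fo[of "f x - y" x] by (simp add: inner_diff_left)
    then show ?thesis by simp
  qed
  have bl: "bounded_linear f"
  proof (rule bounded_linear_intro[where K = 1])
    show "f (x + y) = f x + f y" for x y
    proof (rule uniq[symmetric])
      show "f x + f y \<in> K" using fK sub by (simp add: subspace_add)
      show "inner (x + y - (f x + f y)) k = 0" if "k \<in> K" for k
        using fo[OF that, of x] fo[OF that, of y] by (simp add: inner_diff_left inner_add_left)
    qed
    show "f (r *\<^sub>R x) = r *\<^sub>R f x" for r x
    proof (rule uniq[symmetric])
      show "r *\<^sub>R f x \<in> K" using fK sub by (simp add: subspace_scale)
      show "inner (r *\<^sub>R x - r *\<^sub>R f x) k = 0" if "k \<in> K" for k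
        using fo[OF that, of x] by (simp add: inner_diff_left)
    qed
    show "norm (f x) \<le> norm x * 1" for x
    proof -
      have "(norm (f x))\<^sup>2 = inner x (f x)"
        using fo[OF fK, of x x] by (simp add: inner_diff_left power2_norm_eq_inner)
      also have "\<dots> \<le> norm x * norm (f x)" by (rule norm_cauchy_schwarz)
      finally show ?thesis by (cases "f x = 0") (auto simp: power2_eq_square)
    qed
  qed
  have sym: "inner (f x) y = inner x (f y)" for x y
    using fo[OF fK, of x y] fo[OF fK, of y x]
    by (simp add: inner_diff_left inner_commute[of y "f x"] inner_commute[of "f y" "f x"])
  have fid: "f x = x" if "x \<in> K" for x
    using uniq[of x x] that by simp
  have "orth_proj_onto (Blinfun f) K"
    unfolding orth_proj_onto_def using bl fK sym fid by (simp add: bounded_linear_Blinfun_apply)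
  then show ?thesis by blast
qed

text \<open>Invariance of \<open>K\<close> under \<open>T\<close> means \<open>T P = P T P\<close>; invariance under the adjoint \<open>T'\<close> means
  \<open>P T = P T P\<close>.\<close>

lemma orth_proj_commutes:
  assumes P: "orth_proj_onto P K" and adjoint: "\<And>x y. inner (T x) y = inner x (T' y)"
    and "\<And>x. x \<in> K \<Longrightarrow> T x \<in> K" "\<And>x. x \<in> K \<Longrightarrow> T' x \<in> K"
  shows "P (T x) = T (P x)"
proof -
  have "inner (P (T x)) y = inner (T (P x)) y" for y
  proof -
    have "inner (P (T x)) y = inner x (T' (P y))"
      by (simp add: adjoint orth_proj_ontoD(4)[OF P])
    also have "\<dots> = inner x (P (T' (P y)))"
      using assms orth_proj_ontoD[OF P] by metis
    also have "\<dots> = inner (P (T (P x))) y"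
      by (metis adjoint orth_proj_ontoD(4)[OF P])
    also have "P (T (P x)) = T (P x)"
      using assms orth_proj_ontoD[OF P] by metis
    finally show ?thesis .
  qed
  then show ?thesis by (rule inner_eqI)
qed

text \<open>The representing vector spans the orthogonal complement of the kernel.\<close>

lemma riesz_representation:
  fixes \<phi> :: "'a :: {real_inner, complete_space} \<Rightarrow> real"
  assumes bl: "bounded_linear \<phi>"
  shows "\<exists>y. \<forall>x. \<phi> x = inner y x"
proof (cases "\<forall>x. \<phi> x = 0")
  case True
  then show ?thesis by (intro exI[of _ 0]) simp
next
  case False
  interpret bounded_linear \<phi> by (rule bl)
  obtain x0 where x0: "\<phi> x0 \<noteq> 0" using False by blast
  define K where "K = {x. \<phi> x = 0}"
  have "closed K" unfolding K_def
    by (intro closed_Collect_eq continuous_intros linear_continuous_on bl)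
  moreover have "subspace K" unfolding K_def subspace_def by (simp add: add scaleR)
  ultimately obtain y where y: "y \<in> K" "\<And>k. k \<in> K \<Longrightarrow> inner (x0 - y) k = 0"
    using ex_orthogonal_component by blast
  define u where "u = x0 - y"
  have u: "\<phi> u \<noteq> 0" using x0 y(1) by (simp add: u_def diff K_def)
  then have u0: "inner u u \<noteq> 0" by (auto simp: zero)
  have "\<phi> x = inner ((\<phi> u / inner u u) *\<^sub>R u) x" for x
  proof -
    have "x - (\<phi> x / \<phi> u) *\<^sub>R u \<in> K" using u by (simp add: K_def diff scaleR)
    then have "inner u (x - (\<phi> x / \<phi> u) *\<^sub>R u) = 0"
      using y(2) by (simp add: u_def[symmetric])
    then have "inner u x = \<phi> x / \<phi> u * inner u u"
      by (simp add: inner_diff_right)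
    then show ?thesis using u u0 by simp
  qed
  then show ?thesis by blast
qed

section \<open>Adjoints\<close>

lemma cinner_eq_Complex_inner:
  "cinner x y = Complex (inner x y) (- inner x (\<i> *\<^sub>C y))"
  by (rule complex_eqI) (simp_all add: inner_eq_Re_cinner cinner_scaleC_right)

lemma inner_scaleC_left:
  fixes x y :: "'a :: complex_inner"
  shows "inner (c *\<^sub>C x) y = inner x (cnj c *\<^sub>C y)"
proof -
  have "cinner (c *\<^sub>C x) y = cnj (c * cinner y x)"
    by (subst cinner_commute) (simp only: cinner_scaleC_right)
  also have "\<dots> = cnj c * cinner x y"
    by (simp only: complex_cnj_mult cinner_commute[of x y])
  finally have "cinner (c *\<^sub>C x) y = cnj c * cinner x y" .
  then show ?thesis by (simp add: inner_eq_Re_cinner cinner_scaleC_right)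
qed

lemma bounded_opsD: "T \<in> bounded_ops \<Longrightarrow> T (c *\<^sub>C x) = c *\<^sub>C T x"
  by (simp add: bounded_ops_def)

text \<open>Only the real inner product enters here; for complex linear operators its adjoint is the
  complex one, because the real inner product determines the complex one.\<close>

lemma ex_real_adjoint:
  fixes T :: "'a :: chilbert_space \<Rightarrow>\<^sub>L 'a"
  shows "\<exists>S :: 'a \<Rightarrow>\<^sub>L 'a. \<forall>x y. inner (S x) y = inner x (T y)"
proof -
  have "\<exists>z. \<forall>y. inner x (T y) = inner z y" for x
    by (rule riesz_representation)
      (intro bounded_linear_compose[OF bounded_linear_inner_right blinfun.bounded_linear_right])
  then obtain f where f: "\<And>x y. inner (f x) y = inner x (T y)" by metis
  have bl: "bounded_linear f"
  proof (rule bounded_linear_intro[where K = "norm T"])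
    show "f (x + y) = f x + f y" for x y
      by (rule inner_eqI) (simp add: f inner_add_left)
    show "f (r *\<^sub>R x) = r *\<^sub>R f x" for r x
      by (rule inner_eqI) (simp add: f)
    show "norm (f x) \<le> norm x * norm T" for x
    proof -
      have "(norm (f x))\<^sup>2 = inner x (T (f x))"
        using f by (simp add: power2_norm_eq_inner)
      also have "\<dots> \<le> norm x * norm (T (f x))" by (rule norm_cauchy_schwarz)
      also have "\<dots> \<le> norm x * (norm T * norm (f x))"
        by (intro mult_left_mono norm_blinfun) simp
      finally show ?thesis by (cases "f x = 0") (auto simp: power2_eq_square)
    qed
  qed
  then show ?thesis
    by (intro exI[of _ "Blinfun f"]) (simp add: f bounded_linear_Blinfun_apply)
qed

lemma adj_bounded_ops:
  fixes T :: "'a :: chilbert_space \<Rightarrow>\<^sub>L 'a"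
  assumes T: "T \<in> bounded_ops"
  shows "inner (adj T x) y = inner x (T y)" and "adj T \<in> bounded_ops"
proof -
  obtain S :: "'a \<Rightarrow>\<^sub>L 'a" where S: "\<And>x y. inner (S x) y = inner x (T y)"
    using ex_real_adjoint[of T] by blast
  have "adj T = S"
    unfolding adj_def
  proof (rule the_equality)
    show "\<forall>x y. cinner (S x) y = cinner x (T y)"
      by (simp add: cinner_eq_Complex_inner S bounded_opsD[OF T])
    show "S' = S" if "\<forall>x y. cinner (S' x) y = cinner x (T y)" for S' :: "'a \<Rightarrow>\<^sub>L 'a"
    proof (rule blinfun_eqI)
      fix x
      have "inner (S' x) y = inner (S x) y" for y
        using that S by (simp add: inner_eq_Re_cinner)
      then show "S' x = S x" by (rule inner_eqI)
    qed
  qed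
  moreover have "S (c *\<^sub>C x) = c *\<^sub>C S x" for c x
    by (rule inner_eqI) (simp add: S inner_scaleC_left bounded_opsD[OF T])
  then have "S \<in> bounded_ops" by (simp add: bounded_ops_def)
  ultimately show "inner (adj T x) y = inner x (T y)" "adj T \<in> bounded_ops"
    using S by simp_all
qed

lemma inner_adj_right:
  fixes T :: "'a :: chilbert_space \<Rightarrow>\<^sub>L 'a"
  assumes "T \<in> bounded_ops"
  shows "inner (T x) y = inner x (adj T y)"
  using adj_bounded_ops(1)[OF assms, of y x] inner_commute by metis

text \<open>A symmetric complex linear operator has a real quadratic form: moving the operator to the other
  side turns \<open>\<langle>x, \<i> T x\<rangle>\<close> into its negative.\<close>

lemma positive_opI:
  fixes T :: "'a :: complex_inner \<Rightarrow>\<^sub>L 'a"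
  assumes T: "T \<in> bounded_ops" and sym: "\<And>x y. inner (T x) y = inner x (T y)"
    and pos: "\<And>x. 0 \<le> inner x (T x)"
  shows "positive_op T"
proof -
  have "inner x (\<i> *\<^sub>C T x) = 0" for x
  proof -
    have "inner x (\<i> *\<^sub>C T x) = inner (T x) (\<i> *\<^sub>C x)"
      by (simp add: sym bounded_opsD[OF T])
    also have "\<dots> = inner x (cnj \<i> *\<^sub>C T x)"
      by (simp only: inner_commute[of "T x"] inner_scaleC_left)
    also have "\<dots> = - inner x (\<i> *\<^sub>C T x)"
      using cinner_scaleC_right[of x "cnj \<i>" "T x"] cinner_scaleC_right[of x \<i> "T x"]
      by (simp add: inner_eq_Re_cinner)
    finally show ?thesis by simp
  qed
  then show ?thesis
    unfolding positive_op_def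
    using T pos by (simp add: complex_nonneg_Reals_iff cinner_eq_Complex_inner)
qed

section \<open>Cutting a symmetric operator at a spectral value\<close>

text \<open>If one increment were positive then, increments being nondecreasing, the sequence would grow
  at least linearly.\<close>

lemma convex_sequence_bounded_decreasing:
  fixes b :: "nat \<Rightarrow> real"
  assumes convex: "\<And>n. 2 * b (Suc n) \<le> b n + b (Suc (Suc n))" and bd: "\<And>n. b n \<le> C"
  shows "b (Suc n) \<le> b n"
proof (rule ccontr)
  define \<delta> where "\<delta> = b (Suc n) - b n"
  assume "\<not> b (Suc n) \<le> b n"
  then have \<delta>: "0 < \<delta>" by (simp add: \<delta>_def)
  have step: "\<delta> \<le> b (Suc (n + k)) - b (n + k)" for k
  proof (induction k)
    case (Suc k)
    then show ?case using convex[of "n + k"] by simp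
  qed (simp add: \<delta>_def)
  have grow: "b n + real k * \<delta> \<le> b (n + k)" for k
  proof (induction k)
    case (Suc k)
    then show ?case using step[of k] by (simp add: algebra_simps)
  qed simp
  obtain k where "C - b n < real k * \<delta>" using reals_Archimedean3[OF \<delta>] by blast
  then show False using grow[of k] bd[of "n + k"] by linarith
qed

lemma convex_sequence_le_max:
  fixes b :: "nat \<Rightarrow> real"
  assumes convex: "\<And>n. 2 * b (Suc n) \<le> b n + b (Suc (Suc n))" and "j \<le> n"
  shows "b j \<le> max (b 0) (b n)"
proof -
  have step: "b n \<le> max (b 0) (b (Suc n))" for n
  proof (induction n)
    case (Suc n)
    then show ?case using convex[of n] by linarith
  qed simp
  show ?thesis using \<open>j \<le> n\<close>
  proof (induction n)
    case (Suc n)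
    then show ?case using step[of n] by (cases "j = Suc n") auto
  qed simp
qed

text \<open>For symmetric \<open>f\<close> this is the spectral subspace of \<open>f\<close> for the interval from \<open>-1\<close> to \<open>1\<close>,
  described without functional calculus.\<close>

definition nonexpansive_part :: "('a :: real_normed_vector \<Rightarrow> 'a) \<Rightarrow> 'a set" where
  "nonexpansive_part f = {v. \<forall>n. norm ((f ^^ n) v) \<le> norm v}"

locale symmetric_map =
  fixes f :: "'a :: {real_inner, complete_space} \<Rightarrow> 'a"
  assumes bounded_linear: "bounded_linear f" and symmetric: "inner (f x) y = inner x (f y)"
begin

lemma bounded_linear_funpow: "bounded_linear (f ^^ n)"
proof (induction n)
  case (Suc n)
  then show ?case
    using bounded_linear_compose[OF bounded_linear Suc] by (simp add: o_def)
qed (simp add: id_def bounded_linear_ident)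

lemma symmetric_funpow: "inner ((f ^^ n) x) y = inner x ((f ^^ n) y)"
  by (induction n arbitrary: x y) (simp_all add: symmetric funpow_swap1)

lemma inner_even_power: "inner x ((f ^^ (m + m)) y) = inner ((f ^^ m) x) ((f ^^ m) y)"
  by (simp only: funpow_add o_apply symmetric_funpow)

text \<open>The difference of the two sides is the squared norm of
  \<open>(f ^^ Suc (Suc n)) v - (f ^^ n) v\<close>.\<close>

lemma convex_orbit_norms:
  "2 * (norm ((f ^^ Suc n) v))\<^sup>2 \<le> (norm ((f ^^ n) v))\<^sup>2 + (norm ((f ^^ Suc (Suc n)) v))\<^sup>2"
proof -
  have "0 \<le> inner ((f ^^ Suc (Suc n)) v - (f ^^ n) v) ((f ^^ Suc (Suc n)) v - (f ^^ n) v)"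
    by simp
  also have "\<dots> = (norm ((f ^^ Suc (Suc n)) v))\<^sup>2 - 2 * inner ((f ^^ Suc (Suc n)) v) ((f ^^ n) v)
      + (norm ((f ^^ n) v))\<^sup>2"
    by (simp only: inner_diff_left inner_diff_right power2_norm_eq_inner
        inner_commute[of "(f ^^ n) v" "(f ^^ Suc (Suc n)) v"])
  also have "inner ((f ^^ Suc (Suc n)) v) ((f ^^ n) v) = (norm ((f ^^ Suc n) v))\<^sup>2"
    by (simp add: symmetric power2_norm_eq_inner)
  finally show ?thesis by linarith
qed

text \<open>Convexity of the orbit norms turns any bound into nonincrease. This description by mere
  boundedness is what makes the nonexpansive part a subspace and invariant under every bounded
  operator that commutes with \<open>f\<close>.\<close>

lemma nonexpansive_partI:
  assumes bd: "\<And>n. norm ((f ^^ n) v) \<le> C"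
  shows "v \<in> nonexpansive_part f"
proof -
  have C: "(norm ((f ^^ n) v))\<^sup>2 \<le> C\<^sup>2" for n
    using bd by (intro power_mono) auto
  have step: "(norm ((f ^^ Suc n) v))\<^sup>2 \<le> (norm ((f ^^ n) v))\<^sup>2" for n
    by (rule convex_sequence_bounded_decreasing[where b = "\<lambda>n. (norm ((f ^^ n) v))\<^sup>2",
          OF convex_orbit_norms C])
  have "(norm ((f ^^ n) v))\<^sup>2 \<le> (norm v)\<^sup>2" for n
  proof (induction n)
    case (Suc n)
    then show ?case using step[of n] by linarith
  qed simp
  then have "norm ((f ^^ n) v) \<le> norm v" for n by (rule power2_le_imp_le) simp
  then show ?thesis by (simp add: nonexpansive_part_def)
qed

lemma subspace_nonexpansive_part: "subspace (nonexpansive_part f)"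
proof (rule subspaceI)
  interpret pow: bounded_linear "f ^^ n" for n by (rule bounded_linear_funpow)
  show "0 \<in> nonexpansive_part f" by (simp add: nonexpansive_part_def pow.zero)
  show "x + y \<in> nonexpansive_part f"
    if "x \<in> nonexpansive_part f" "y \<in> nonexpansive_part f" for x y
  proof (rule nonexpansive_partI)
    show "norm ((f ^^ n) (x + y)) \<le> norm x + norm y" for n
      using that norm_triangle_ineq[of "(f ^^ n) x" "(f ^^ n) y"]
      unfolding nonexpansive_part_def pow.add by (smt (verit) mem_Collect_eq)
  qed
  show "c *\<^sub>R x \<in> nonexpansive_part f" if "x \<in> nonexpansive_part f" for c x
    using that by (simp add: nonexpansive_part_def pow.scaleR mult_left_mono)
qed

lemma closed_nonexpansive_part: "closed (nonexpansive_part f)"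
proof -
  have eq: "nonexpansive_part f = (\<Inter>n. {v. norm ((f ^^ n) v) \<le> norm v})"
    by (auto simp: nonexpansive_part_def)
  show ?thesis
    unfolding eq
    by (intro closed_INT ballI closed_Collect_le continuous_intros linear_continuous_on
        bounded_linear_funpow)
qed

lemma nonexpansive_part_invariant:
  assumes T: "bounded_linear T" and commutes: "\<And>x. T (f x) = f (T x)"
    and v: "v \<in> nonexpansive_part f"
  shows "T v \<in> nonexpansive_part f"
proof -
  have pow: "(f ^^ n) (T v) = T ((f ^^ n) v)" for n
    by (induction n) (simp_all add: commutes)
  obtain C where "0 \<le> C" "\<And>x. norm (T x) \<le> norm x * C"
    using bounded_linear.nonneg_bounded[OF T] by blast
  moreover have "norm ((f ^^ n) v) \<le> norm v" for n
    using v by (simp add: nonexpansive_part_def)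
  ultimately have "norm ((f ^^ n) (T v)) \<le> norm v * C" for n
    unfolding pow using mult_right_mono order_trans by blast
  then show ?thesis by (rule nonexpansive_partI)
qed

text \<open>The operator \<open>1 + f ^^ (m + m)\<close> is symmetric and at least \<open>1\<close>, since
  \<open>f ^^ (m + m)\<close> is the square of a symmetric operator. So it is bounded below, its range is
  closed, and a vector orthogonal to the range vanishes.\<close>

lemma surj_id_plus_even_power: "\<exists>w. w + (f ^^ (m + m)) w = v"
proof -
  define g where "g w = w + (f ^^ (m + m)) w" for w
  have bl: "bounded_linear g"
    unfolding g_def by (intro bounded_linear_add bounded_linear_ident bounded_linear_funpow)
  have form: "inner w (g w) = (norm w)\<^sup>2 + (norm ((f ^^ m) w))\<^sup>2" for w
    by (simp only: g_def inner_add_right power2_norm_eq_inner inner_even_power)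
  have below: "1 * norm w \<le> norm (g w)" for w
  proof -
    have "norm w * norm w \<le> inner w (g w)" using form[of w] by (simp add: power2_eq_square)
    also have "\<dots> \<le> norm w * norm (g w)" by (rule norm_cauchy_schwarz)
    finally show ?thesis by (cases "w = 0") auto
  qed
  have "complete (range g)"
    by (rule complete_isometric_image[where e = 1])
      (use below bl in \<open>auto simp: complete_UNIV\<close>)
  then have cl: "closed (range g)" by (rule complete_imp_closed)
  have "subspace (range g)"
    by (rule linear_subspace_image) (use bl bounded_linear.linear in auto)
  from ex_orthogonal_component[OF cl this, of v]
  obtain y where y: "y \<in> range g" "\<forall>k\<in>range g. inner (v - y) k = 0" by (rule bexE)
  have "inner (v - y) (g (v - y)) = 0" using y(2) by (rule bspec) (rule rangeI)
  then have "(norm (v - y))\<^sup>2 = 0"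
    using form[of "v - y"] zero_le_power2[of "norm (v - y)"]
      zero_le_power2[of "norm ((f ^^ m) (v - y))"] by linarith
  then have "v = y" by simp
  then show ?thesis using y(1) by (metis g_def imageE)
qed

text \<open>If \<open>f\<close> shrinks \<open>v\<close>, then \<open>v\<close> is not orthogonal to the nonexpansive part. A common point of
  the sets \<open>F n\<close> witnesses this: its orbit is bounded and its inner product with \<open>v\<close> is at least
  \<open>\<delta> > 0\<close>. The set \<open>F m\<close> contains \<open>w = (1 + f ^^ (m + m))\<inverse> v\<close>, an approximation to the image of \<open>v\<close>
  under the spectral projection. The bound on \<open>inner w v\<close> expresses that
  \<open>1 / (1 + x ^ (2 m)) \<ge> (1 - x\<^sup>2) / 2\<close> for real \<open>x\<close>; it follows from the convexity of the numbers
  \<open>b n\<close>.\<close>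

lemma norm_le_on_orthogonal_complement:
  assumes orth: "\<And>k. k \<in> nonexpansive_part f \<Longrightarrow> inner v k = 0"
  shows "norm v \<le> norm (f v)"
proof (rule ccontr)
  assume less: "\<not> norm v \<le> norm (f v)"
  define \<delta> where "\<delta> = ((norm v)\<^sup>2 - (norm (f v))\<^sup>2) / 2"
  have \<delta>: "0 < \<delta>" using less by (simp add: \<delta>_def power_strict_mono)
  define F where
    "F n = {w. (\<forall>j\<le>n. norm ((f ^^ j) w) \<le> norm v) \<and> \<delta> \<le> inner w v}" for n
  have "\<exists>w. \<forall>n. w \<in> F n"
  proof (rule nested_closed_convex_nonempty)
    interpret pow: bounded_linear "f ^^ n" for n by (rule bounded_linear_funpow)
    show "closed (F n)" for n
    proof -
      have F: "F n = (\<Inter>j\<in>{..n}. {w. norm ((f ^^ j) w) \<le> norm v}) \<inter> {w. \<delta> \<le> inner w v}"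
        by (auto simp: F_def)
      show ?thesis
        unfolding F
        by (intro closed_Int closed_INT ballI closed_Collect_le continuous_intros
            linear_continuous_on bounded_linear_funpow)
    qed
    show "convex (F n)" for n
    proof (rule convexI)
      fix x y and s t :: real
      assume xy: "x \<in> F n" "y \<in> F n" and st: "0 \<le> s" "0 \<le> t" "s + t = 1"
      have "norm ((f ^^ j) (s *\<^sub>R x + t *\<^sub>R y)) \<le> norm v" if "j \<le> n" for j
      proof -
        have "(f ^^ j) x \<in> cball 0 (norm v)" "(f ^^ j) y \<in> cball 0 (norm v)"
          using xy that by (auto simp: F_def)
        then have "s *\<^sub>R (f ^^ j) x + t *\<^sub>R (f ^^ j) y \<in> cball 0 (norm v)"
          using st by (intro convexD convex_cball)
        then show ?thesis by (simp add: pow.add pow.scaleR)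
      qed
      moreover have "\<delta> \<le> inner (s *\<^sub>R x + t *\<^sub>R y) v"
      proof -
        have "s * \<delta> + t * \<delta> \<le> s * inner x v + t * inner y v"
          using xy st by (intro add_mono mult_left_mono) (auto simp: F_def)
        then show ?thesis
          using st by (simp add: inner_add_left distrib_right[symmetric])
      qed
      ultimately show "s *\<^sub>R x + t *\<^sub>R y \<in> F n" by (simp add: F_def)
    qed
    show "decseq F" unfolding decseq_def F_def by auto
    show "norm w \<le> norm v" if "w \<in> F 0" for w using that by (simp add: F_def)
    show "F m \<noteq> {}" for m
    proof -
      obtain w where w: "w + (f ^^ (m + m)) w = v" using surj_id_plus_even_power by blast
      define b where "b n = (norm ((f ^^ n) w))\<^sup>2" for n
      have convex: "2 * b (Suc n) \<le> b n + b (Suc (Suc n))" for n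
        unfolding b_def by (rule convex_orbit_norms)
      have b0: "0 \<le> b n" for n by (simp add: b_def)
      have half: "inner w ((f ^^ (m + m)) w) = b m"
        by (simp only: b_def power2_norm_eq_inner inner_even_power)
      have norm_add: "(norm (x + y))\<^sup>2 = (norm x)\<^sup>2 + 2 * inner x y + (norm y)\<^sup>2" for x y :: 'a
        by (simp add: power2_norm_eq_inner inner_add_left inner_add_right inner_commute[of y x])
      have v: "(norm v)\<^sup>2 = b 0 + 2 * b m + b (m + m)"
        unfolding w[symmetric] norm_add half by (simp add: b_def)
      have fv: "f v = f w + (f ^^ Suc (m + m)) w"
        unfolding w[symmetric] using bounded_linear.linear[OF bounded_linear]
        by (simp add: linear_add)
      have cross: "inner (f w) ((f ^^ Suc (m + m)) w) = b (Suc m)"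
        unfolding b_def power2_norm_eq_inner funpow_Suc_right o_apply inner_even_power ..
      have "(norm (f v))\<^sup>2 = b 1 + 2 * b (Suc m) + b (Suc (m + m))"
        unfolding fv norm_add cross by (simp add: b_def)
      moreover have "b (m + m) \<le> max (b 0) (b (Suc (m + m)))"
        by (rule convex_sequence_le_max[where b = b, OF convex]) simp
      ultimately have "\<delta> \<le> b 0 + b m"
        unfolding \<delta>_def v using b0[of 0] b0[of 1] b0[of "Suc m"] b0[of "Suc (m + m)"]
        by (simp add: field_simps)
      also have "b 0 + b m = inner w v"
        unfolding w[symmetric] inner_add_right half by (simp add: b_def power2_norm_eq_inner)
      finally have "\<delta> \<le> inner w v" .
      moreover have "norm ((f ^^ j) w) \<le> norm v" if "j \<le> m" for j
      proof -
        have "b j \<le> max (b 0) (b (m + m))"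
          by (rule convex_sequence_le_max[where b = b, OF convex]) (use that in simp)
        then have "b j \<le> (norm v)\<^sup>2"
          unfolding v using b0[of 0] b0[of m] b0[of "m + m"] by linarith
        then show ?thesis unfolding b_def by (rule power2_le_imp_le) simp
      qed
      ultimately show ?thesis unfolding F_def by blast
    qed
  qed
  then obtain w where "\<And>n. w \<in> F n" by blast
  then have w: "\<And>n. norm ((f ^^ n) w) \<le> norm v" "\<delta> \<le> inner w v" by (auto simp: F_def)
  have "inner v w = 0" by (rule orth[OF nonexpansive_partI[OF w(1)]])
  then show False using w(2) \<delta> by (simp add: inner_commute)
qed

end

section \<open>Projections in von Neumann algebras\<close>

lemma unital_subalgebraD:
  assumes "unital_subalgebra A"
  shows "A \<subseteq> bounded_ops" "id_blinfun \<in> A" "S \<in> A \<Longrightarrow> T \<in> A \<Longrightarrow> S + T \<in> A"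
    "T \<in> A \<Longrightarrow> c *\<^sub>C T \<in> A" "S \<in> A \<Longrightarrow> T \<in> A \<Longrightarrow> S o\<^sub>L T \<in> A"
  using assms unfolding unital_subalgebra_def by auto

lemma unital_subalgebra_scaleR:
  "unital_subalgebra A \<Longrightarrow> T \<in> A \<Longrightarrow> r *\<^sub>R T \<in> A"
  by (simp add: scaleR_scaleC unital_subalgebraD(4))

lemma unital_subalgebra_diff:
  assumes "unital_subalgebra A" "S \<in> A" "T \<in> A"
  shows "S - T \<in> A"
  using unital_subalgebraD(3)[OF assms(1,2) unital_subalgebra_scaleR[OF assms(1,3), of "-1"]]
  by simp

lemma von_neumann_algebraD:
  assumes "von_neumann_algebra M"
  shows "unital_subalgebra M" "M \<subseteq> bounded_ops" "T \<in> M \<Longrightarrow> T \<in> bounded_ops"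
    "T \<in> M \<Longrightarrow> adj T \<in> M" "commutant (commutant M) = M"
  using assms unital_subalgebraD(1) unfolding von_neumann_algebra_def by blast+

lemma commutant_applyD: "T \<in> commutant S \<Longrightarrow> s \<in> S \<Longrightarrow> T (s x) = s (T x)"
proof -
  assume "T \<in> commutant S" "s \<in> S"
  then have "(T o\<^sub>L s) x = (s o\<^sub>L T) x" unfolding commutant_def by simp
  then show ?thesis by simp
qed

lemma adj_commutant:
  fixes M :: "('a :: chilbert_space \<Rightarrow>\<^sub>L 'a) set"
  assumes M: "von_neumann_algebra M" and T: "T \<in> commutant M"
  shows "adj T \<in> commutant M"
proof -
  have Tb: "T \<in> bounded_ops" using T by (simp add: commutant_def)
  have "adj T o\<^sub>L s = s o\<^sub>L adj T" if s: "s \<in> M" for s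
  proof (rule blinfun_eqI, rule inner_eqI)
    fix x y
    have sb: "s \<in> bounded_ops" and s': "adj s \<in> M" using s von_neumann_algebraD[OF M] by auto
    have "inner (adj T (s x)) y = inner x (adj s (T y))"
      by (simp add: adj_bounded_ops(1)[OF Tb] inner_adj_right[OF sb])
    also have "\<dots> = inner x (T (adj s y))" by (simp add: commutant_applyD[OF T s'])
    also have "\<dots> = inner (s (adj T x)) y"
      by (simp add: adj_bounded_ops(1)[OF Tb] inner_adj_right[OF sb])
    finally show "inner ((adj T o\<^sub>L s) x) y = inner ((s o\<^sub>L adj T) x) y" by simp
  qed
  then show ?thesis unfolding commutant_def using adj_bounded_ops(2)[OF Tb] by blast
qed

lemma orth_proj_bounded_ops:
  fixes P :: "'a :: complex_inner \<Rightarrow>\<^sub>L 'a"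
  assumes P: "orth_proj_onto P K" and K: "\<And>c x. x \<in> K \<Longrightarrow> c *\<^sub>C x \<in> K"
  shows "P \<in> bounded_ops"
proof -
  have "P (c *\<^sub>C x) = c *\<^sub>C P x" for c x
    by (rule orth_proj_commutes[OF P, where T' = "\<lambda>x. cnj c *\<^sub>C x"])
      (simp_all add: inner_scaleC_left K)
  then show ?thesis by (simp add: bounded_ops_def)
qed

text \<open>By selfadjointness of the commutant its elements commute with the projection, and the
  double commutant gives membership.\<close>

lemma orth_proj_in_von_neumann_algebra:
  fixes M :: "('a :: chilbert_space \<Rightarrow>\<^sub>L 'a) set"
  assumes M: "von_neumann_algebra M" and P: "orth_proj_onto P K"
    and K: "\<And>c x. x \<in> K \<Longrightarrow> c *\<^sub>C x \<in> K"
    and inv: "\<And>T x. T \<in> commutant M \<Longrightarrow> x \<in> K \<Longrightarrow> T x \<in> K"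
  shows "P \<in> M"
proof -
  have "P o\<^sub>L T = T o\<^sub>L P" if T: "T \<in> commutant M" for T
  proof (rule blinfun_eqI)
    fix x
    have Tb: "T \<in> bounded_ops" using T by (simp add: commutant_def)
    have "P (T x) = T (P x)"
      by (rule orth_proj_commutes[OF P inner_adj_right[OF Tb]])
        (use inv T adj_commutant[OF M T] in auto)
    then show "(P o\<^sub>L T) x = (T o\<^sub>L P) x" by simp
  qed
  then have "P \<in> commutant (commutant M)"
    using orth_proj_bounded_ops[OF P K] by (simp add: commutant_def)
  then show ?thesis by (simp add: von_neumann_algebraD(5)[OF M])
qed

text \<open>If \<open>e\<close> annihilates \<open>y (f u)\<close> for all \<open>y \<in> M\<close> and all \<open>u\<close>, then the closed subspace \<open>L\<close> of vectors \<open>u\<close> with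
  \<open>e (y u) = 0\<close> for all \<open>y\<close> contains the range of \<open>f\<close>. It is invariant under \<open>M\<close> and its commutant,
  so the projection onto it is central and hence \<open>0\<close> or \<open>1\<close>, which forces \<open>f = 0\<close> or \<open>e = 0\<close>.\<close>

lemma factor_corner_nonzero:
  fixes M :: "('a :: chilbert_space \<Rightarrow>\<^sub>L 'a) set"
  assumes F: "is_factor M" and "e \<in> M" "f \<in> M" "e \<noteq> 0" "f \<noteq> 0"
  shows "\<exists>y\<in>M. e o\<^sub>L y o\<^sub>L f \<noteq> 0"
proof (rule ccontr)
  assume none: "\<not> (\<exists>y\<in>M. e o\<^sub>L y o\<^sub>L f \<noteq> 0)"
  have M: "von_neumann_algebra M" and cen: "center M = {c *\<^sub>C id_blinfun | c. True}"
    using F by (auto simp: is_factor_def)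
  note unital = von_neumann_algebraD(1)[OF M]
  define L where "L = {u. \<forall>y\<in>M. e (y u) = 0}"
  have ebd: "e \<in> bounded_ops" using assms von_neumann_algebraD(3)[OF M] by auto
  have "L = (\<Inter>y\<in>M. {u. e (blinfun_apply y u) = 0})" by (auto simp: L_def)
  then have "closed L"
    by (auto intro!: closed_INT closed_Collect_eq continuous_intros)
  moreover have "subspace L"
    by (auto simp: L_def subspace_def blinfun.bilinear_simps)
  ultimately obtain P where P: "orth_proj_onto P L" using ex_orth_proj_onto by blast
  have Lc: "c *\<^sub>C u \<in> L" if "u \<in> L" for c u
  proof -
    have "e (y (c *\<^sub>C u)) = 0" if y: "y \<in> M" for y
    proof -
      have "e (y (c *\<^sub>C u)) = c *\<^sub>C e (y u)"
        by (simp add: bounded_opsD[OF ebd] bounded_opsD[OF von_neumann_algebraD(3)[OF M y]])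
      also have "e (y u) = 0" using \<open>u \<in> L\<close> y by (simp add: L_def)
      also have "c *\<^sub>C (0 :: 'a) = 0" using norm_scaleC[of c "0 :: 'a"] by simp
      finally show ?thesis .
    qed
    then show ?thesis by (simp add: L_def)
  qed
  have LM: "s u \<in> L" if "s \<in> M" "u \<in> L" for s u
  proof -
    have "e (y (s u)) = 0" if "y \<in> M" for y
      using \<open>u \<in> L\<close> unital_subalgebraD(5)[OF unital that \<open>s \<in> M\<close>] by (auto simp: L_def)
    then show ?thesis by (simp add: L_def)
  qed
  have "P \<in> M"
  proof (rule orth_proj_in_von_neumann_algebra[OF M P Lc])
    show "T u \<in> L" if "T \<in> commutant M" "u \<in> L" for T u
    proof -
      have "e (y (T u)) = T (e (y u))" if "y \<in> M" for y
        using commutant_applyD[OF \<open>T \<in> commutant M\<close>] \<open>e \<in> M\<close> that by simp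
      then show ?thesis using \<open>u \<in> L\<close> by (simp add: L_def)
    qed
  qed
  moreover have "P o\<^sub>L s = s o\<^sub>L P" if s: "s \<in> M" for s
  proof (rule blinfun_eqI)
    fix x
    have "P (s x) = s (P x)"
      by (rule orth_proj_commutes[OF P inner_adj_right])
        (use s LM von_neumann_algebraD[OF M] in auto)
    then show "(P o\<^sub>L s) x = (s o\<^sub>L P) x" by simp
  qed
  ultimately have "P \<in> center M" by (simp add: center_def)
  then obtain c where c: "P = c *\<^sub>C id_blinfun" using cen by auto
  have Pc: "P x = c *\<^sub>C x" for x unfolding c by (simp add: scaleC_blinfun.rep_eq)
  obtain u where u: "f u \<noteq> 0" using \<open>f \<noteq> 0\<close> blinfun_eqI[of f 0] by auto
  have "(e o\<^sub>L y o\<^sub>L f) u = 0" if "y \<in> M" for y using none that by auto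
  then have "f u \<in> L" by (simp add: L_def)
  then have "c *\<^sub>C f u = f u" using orth_proj_ontoD(2)[OF P] Pc by simp
  then have "(c - 1) *\<^sub>C f u = 0"
    using scaleC_add_left[of "c - 1" 1 "f u"] by (simp add: scaleC_one)
  then have "c = 1" using u norm_scaleC[of "c - 1" "f u"] by simp
  then have "x \<in> L" for x using orth_proj_ontoD(1)[OF P, of x] by (simp add: Pc scaleC_one)
  then have "e (id_blinfun x) = 0" for x
    using unital_subalgebraD(2)[OF unital] unfolding L_def by blast
  then show False using \<open>e \<noteq> 0\<close> blinfun_eqI[of e 0] by auto
qed

section \<open>Almost isometries from logmodularity\<close>

lemma norm_symmetric_idempotent_le:
  assumes sym: "\<And>x y. inner (p x) y = inner x (p y)" and idem: "\<And>x. p (p x) = p x"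
  shows "norm (p x) \<le> norm x" "norm (x - p x) \<le> norm x"
    and "(norm (x - p x))\<^sup>2 = (norm x)\<^sup>2 - (norm (p x))\<^sup>2"
proof -
  have pp: "inner x (p x) = (norm (p x))\<^sup>2"
    by (metis sym idem power2_norm_eq_inner)
  show eq: "(norm (x - p x))\<^sup>2 = (norm x)\<^sup>2 - (norm (p x))\<^sup>2"
    using pp by (simp add: power2_norm_eq_inner inner_diff_left inner_diff_right
        inner_commute[of "p x" x])
  show "norm (p x) \<le> norm x"
    by (rule power2_le_imp_le) (use eq zero_le_power2[of "norm (x - p x)"] in linarith, simp)
  show "norm (x - p x) \<le> norm x"
    by (rule power2_le_imp_le) (use eq zero_le_power2[of "norm (p x)"] in linarith, simp)
qed

text \<open>Here \<open>a\<close> is almost an isometry from the space with the inner product \<open>\<langle>z v, z w\<rangle>\<close> to the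
  original one, and maps the range of \<open>r\<close> onto itself. So a vector that is orthogonal to that range
  in the new inner product has an image almost orthogonal to it.\<close>

lemma almost_orthogonal_image:
  fixes a b r z :: "'a :: real_inner \<Rightarrow>\<^sub>L 'a"
  assumes err: "\<And>v w. \<bar>inner (a v) (a w) - inner (z v) (z w)\<bar> \<le> \<epsilon> * norm v * norm w"
    and "0 \<le> \<epsilon>" and lower: "\<And>v. norm v \<le> C * norm (a v)" and ab: "\<And>x. a (b x) = x"
    and rsym: "\<And>x y. inner (r x) y = inner x (r y)" and ridem: "\<And>x. r (r x) = r x"
    and rb: "\<And>x. r (b (r x)) = b (r x)"
    and orth: "\<And>y. inner (z x) (z (r y)) = 0"
  shows "norm (r (a x)) \<le> \<epsilon> * C * norm x"
proof -
  define u where "u = r (a x)"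
  define y where "y = b u"
  have ru: "r u = u" by (simp add: u_def ridem)
  have ry: "r y = y" using rb[of u] by (simp add: y_def ru)
  have ay: "a y = u" by (simp add: y_def ab)
  have "(norm u)\<^sup>2 = inner (r (a x)) u" by (simp add: power2_norm_eq_inner u_def)
  also have "\<dots> = inner (a x) (a y)" by (simp only: rsym ru ay)
  also have "\<dots> \<le> \<epsilon> * norm x * norm y"
    using err[of x y] orth[of y] by (simp add: ry)
  also have "\<dots> \<le> \<epsilon> * norm x * (C * norm u)"
    using lower[of y] \<open>0 \<le> \<epsilon>\<close> by (intro mult_left_mono) (simp_all add: ay)
  finally have "norm u * norm u \<le> (\<epsilon> * C * norm x) * norm u"
    by (simp add: power2_eq_square mult_ac)
  moreover have "0 \<le> \<epsilon> * C * norm x" if "u = 0"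
  proof -
    have "0 \<le> C * norm (a x)" using lower[of x] norm_ge_zero order_trans by blast
    then have "0 \<le> C \<or> norm x = 0"
      using lower[of x] by (auto simp: zero_le_mult_iff)
    then show ?thesis using \<open>0 \<le> \<epsilon>\<close> by auto
  qed
  ultimately show ?thesis unfolding u_def[symmetric] by (cases "u = 0") auto
qed

locale logmodular_subalgebra =
  fixes M A :: "('a :: chilbert_space \<Rightarrow>\<^sub>L 'a) set"
  assumes von_neumann: "von_neumann_algebra M" and subalgebra: "unital_subalgebra A"
    and subset: "A \<subseteq> M" and logmodular: "logmodular M A"
begin

lemmas unital_M = von_neumann_algebraD(1)[OF von_neumann]

lemma M_bounded_ops: "T \<in> M \<Longrightarrow> T \<in> bounded_ops"
  by (rule von_neumann_algebraD(3)[OF von_neumann])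

lemma LatD:
  assumes "p \<in> Lat M A"
  shows "p \<in> M" "p (p x) = p x" "inner (p x) y = inner x (p y)"
    and "a \<in> A \<Longrightarrow> p (a (p x)) = a (p x)"
proof -
  have p: "p \<in> M" "p o\<^sub>L p = p" "adj p = p" "\<And>a. a \<in> A \<Longrightarrow> a o\<^sub>L p = p o\<^sub>L a o\<^sub>L p"
    using assms by (auto simp: Lat_def)
  show "p \<in> M" by fact
  show "p (p x) = p x" using p(2) by (metis blinfun_apply_blinfun_compose)
  show "inner (p x) y = inner x (p y)"
    using adj_bounded_ops(1)[OF M_bounded_ops[OF p(1)], of x y] p(3) by simp
  show "p (a (p x)) = a (p x)" if "a \<in> A"
    using p(4)[OF that] by (metis blinfun_apply_blinfun_compose)
qed

text \<open>Approximate \<open>z\<^sup>* z\<close> by \<open>a\<^sup>* a\<close> with \<open>a\<close> invertible in \<open>A\<close>. Thus every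
  inner product \<open>\<langle>z v, z w\<rangle>\<close> can be moved to the original one, up to \<open>\<epsilon>\<close>, by an operator that
  preserves all invariant subspaces of \<open>A\<close>.\<close>

lemma ex_almost_isometry:
  assumes z: "z \<in> M" "z' \<in> M" and inv: "z o\<^sub>L z' = id_blinfun" "z' o\<^sub>L z = id_blinfun"
    and "0 < \<epsilon>"
  shows "\<exists>a\<in>A. \<exists>b\<in>A. (\<forall>x. a (b x) = x) \<and> (\<forall>x. b (a x) = x) \<and>
    (\<forall>v w. \<bar>inner (a v) (a w) - inner (z v) (z w)\<bar> \<le> \<epsilon> * norm v * norm w)"
proof -
  define g where "g = adj z o\<^sub>L z"
  define h where "h = z' o\<^sub>L adj z'"
  note zb = M_bounded_ops[OF z(1)] and z'b = M_bounded_ops[OF z(2)]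
  have zz': "z (z' x) = x" "z' (z x) = x" for x
    using inv by (metis blinfun_apply_blinfun_compose blinfun_apply_id_blinfun id_apply)+
  have gM: "g \<in> M" "h \<in> M"
    unfolding g_def h_def
    using z von_neumann_algebraD(4)[OF von_neumann] unital_subalgebraD(5)[OF unital_M] by auto
  have form: "inner (g x) y = inner (z x) (z y)" for x y
    by (simp add: g_def adj_bounded_ops(1)[OF zb])
  have "adj z' (adj z x) = x" "adj z (adj z' x) = x" for x
    by (rule inner_eqI; simp add: adj_bounded_ops(1)[OF zb] adj_bounded_ops(1)[OF z'b] zz')+
  then have "g o\<^sub>L h = id_blinfun" "h o\<^sub>L g = id_blinfun"
    by (auto intro!: blinfun_eqI simp: g_def h_def zz')
  then have "g \<in> invertibles M" using gM by (auto simp: invertibles_def)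
  moreover have "positive_op g"
  proof (rule positive_opI[OF M_bounded_ops[OF gM(1)]])
    show sym: "inner (g x) y = inner x (g y)" for x y
      using form[of x y] form[of y x] by (simp add: inner_commute)
    show "0 \<le> inner x (g x)" for x unfolding sym[symmetric] form by simp
  qed
  ultimately have "g \<in> closure {adj a o\<^sub>L a | a. a \<in> invertibles A}"
    using logmodular by (auto simp: logmodular_def positive_invertibles_def)
  then obtain a where a: "a \<in> invertibles A" "dist (adj a o\<^sub>L a) g < \<epsilon>"
    using \<open>0 < \<epsilon>\<close> unfolding closure_approachable by blast
  then obtain b where ab: "a \<in> A" "b \<in> A" "a o\<^sub>L b = id_blinfun" "b o\<^sub>L a = id_blinfun"
    by (auto simp: invertibles_def)
  then have ab': "a (b x) = x" "b (a x) = x" for x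
    by (metis blinfun_apply_blinfun_compose blinfun_apply_id_blinfun id_apply)+
  have abd: "a \<in> bounded_ops" using ab(1) subset M_bounded_ops by blast
  have "\<bar>inner (a v) (a w) - inner (z v) (z w)\<bar> \<le> \<epsilon> * norm v * norm w" for v w
  proof -
    have "inner (a v) (a w) - inner (z v) (z w) = inner (((adj a o\<^sub>L a) - g) v) w"
      by (simp add: blinfun.diff_left inner_diff_left adj_bounded_ops(1)[OF abd] form)
    also have "\<bar>\<dots>\<bar> \<le> norm (((adj a o\<^sub>L a) - g) v) * norm w" by (rule Cauchy_Schwarz_ineq2)
    also have "\<dots> \<le> norm ((adj a o\<^sub>L a) - g) * norm v * norm w"
      by (intro mult_right_mono norm_blinfun) simp
    also have "\<dots> \<le> \<epsilon> * norm v * norm w"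
      using a(2) by (intro mult_right_mono) (auto simp: dist_norm)
    finally show ?thesis .
  qed
  then show ?thesis using ab ab' by blast
qed

text \<open>The point of \<open>C\<close> is that it depends on \<open>z\<close> alone: the errors of the approximation can then be
  made small compared with the distortion by \<open>a\<close>.\<close>

lemma ex_bounded_almost_isometry:
  assumes z: "z \<in> M" "z' \<in> M" and inv: "z o\<^sub>L z' = id_blinfun" "z' o\<^sub>L z = id_blinfun"
  shows "\<exists>C>0. \<forall>\<epsilon>>0. \<exists>a\<in>A. \<exists>b\<in>A. (\<forall>x. a (b x) = x) \<and> (\<forall>x. b (a x) = x) \<and>
    (\<forall>v w. \<bar>inner (a v) (a w) - inner (z v) (z w)\<bar> \<le> \<epsilon> * norm v * norm w) \<and>
    (\<forall>v. norm v \<le> C * norm (a v)) \<and> (\<forall>v. norm (a v) \<le> C * norm v)"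
proof -
  define K where "K = norm z' + 1"
  define C where "C = 2 * K + norm z + 1"
  have K: "0 < K" unfolding K_def using norm_ge_zero[of z'] by linarith
  have C: "2 * K \<le> C" "norm z + 1 \<le> C" using K by (simp_all add: C_def)
  then have C0: "0 < C" using K by linarith
  have zlow: "norm v \<le> K * norm (z v)" for v
  proof -
    have "norm v = norm (z' (z v))"
      using inv(2) by (metis blinfun_apply_blinfun_compose blinfun_apply_id_blinfun id_apply)
    also have "\<dots> \<le> norm z' * norm (z v)" by (rule norm_blinfun)
    also have "\<dots> \<le> K * norm (z v)" by (simp add: K_def mult_right_mono)
    finally show ?thesis .
  qed
  have main: "\<exists>a\<in>A. \<exists>b\<in>A. (\<forall>x. a (b x) = x) \<and> (\<forall>x. b (a x) = x) \<and>
    (\<forall>v w. \<bar>inner (a v) (a w) - inner (z v) (z w)\<bar> \<le> \<epsilon> * norm v * norm w) \<and>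
    (\<forall>v. norm v \<le> C * norm (a v)) \<and> (\<forall>v. norm (a v) \<le> C * norm v)" if "0 < \<epsilon>" for \<epsilon>
  proof -
    \<comment> \<open>At most \<open>3 / (4 K\<^sup>2)\<close>, so that the error uses up at most three quarters of the lower
      bound for \<open>z\<close>; at most \<open>1\<close> for the upper bound.\<close>
    define \<delta> where "\<delta> = min \<epsilon> (min 1 (3 / (4 * K\<^sup>2)))"
    have \<delta>: "0 < \<delta>" "\<delta> \<le> \<epsilon>" "\<delta> \<le> 1" "\<delta> \<le> 3 / (4 * K\<^sup>2)" using that K by (auto simp: \<delta>_def)
    have \<delta>K: "4 * K\<^sup>2 * \<delta> \<le> 3" using \<delta>(4) K by (simp add: field_simps)
    obtain a b where ab: "a \<in> A" "b \<in> A" "\<And>x. a (b x) = x" "\<And>x. b (a x) = x"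
      and err: "\<And>v w. \<bar>inner (a v) (a w) - inner (z v) (z w)\<bar> \<le> \<delta> * norm v * norm w"
      using ex_almost_isometry[OF z inv \<delta>(1)] by blast
    have sq: "\<bar>(norm (a v))\<^sup>2 - (norm (z v))\<^sup>2\<bar> \<le> \<delta> * (norm v)\<^sup>2" for v
      using err[of v v] by (simp add: power2_norm_eq_inner[symmetric] power2_eq_square mult.assoc)
    have "norm v \<le> C * norm (a v)" for v
    proof -
      have "(norm v)\<^sup>2 \<le> (K * norm (z v))\<^sup>2" using zlow by (intro power_mono) auto
      then have "4 * (norm v)\<^sup>2 \<le> 4 * K\<^sup>2 * (norm (z v))\<^sup>2"
        by (simp add: power_mult_distrib)
      also have "\<dots> \<le> 4 * K\<^sup>2 * ((norm (a v))\<^sup>2 + \<delta> * (norm v)\<^sup>2)"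
        using sq[of v] by (intro mult_left_mono) auto
      also have "\<dots> \<le> (2 * K * norm (a v))\<^sup>2 + 3 * (norm v)\<^sup>2"
        using mult_right_mono[OF \<delta>K, of "(norm v)\<^sup>2"]
        by (simp add: power_mult_distrib algebra_simps)
      finally have "(norm v)\<^sup>2 \<le> (2 * K * norm (a v))\<^sup>2" by simp
      then have "norm v \<le> 2 * K * norm (a v)" by (rule power2_le_imp_le) (use K in simp)
      also have "\<dots> \<le> C * norm (a v)" using C(1) by (intro mult_right_mono) auto
      finally show ?thesis .
    qed
    moreover have "norm (a v) \<le> C * norm v" for v
    proof -
      have "(norm (a v))\<^sup>2 \<le> (norm (z v))\<^sup>2 + \<delta> * (norm v)\<^sup>2" using sq[of v] by linarith
      also have "\<dots> \<le> (norm z * norm v)\<^sup>2 + 1 * (norm v)\<^sup>2"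
        using \<delta>(3) by (intro add_mono power_mono mult_right_mono norm_blinfun) auto
      also have "\<dots> \<le> ((norm z + 1) * norm v)\<^sup>2"
        by (simp add: power2_eq_square algebra_simps)
      finally have "norm (a v) \<le> (norm z + 1) * norm v" by (rule power2_le_imp_le) simp
      also have "\<dots> \<le> C * norm v" using C(2) by (intro mult_right_mono) auto
      finally show ?thesis .
    qed
    moreover have "\<bar>inner (a v) (a w) - inner (z v) (z w)\<bar> \<le> \<epsilon> * norm v * norm w" for v w
    proof -
      have "\<delta> * norm v * norm w \<le> \<epsilon> * norm v * norm w" using \<delta>(2) by (intro mult_right_mono) auto
      then show ?thesis using err[of v w] by linarith
    qed
    ultimately show ?thesis using ab by blast
  qed
  then show ?thesis using C0 by blast
qed

section \<open>Two invariant projections\<close>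

text \<open>The assumption \<open>zp\<close> says that \<open>p\<close> is also the orthogonal projection for the inner product
  \<open>\<langle>z x, z y\<rangle>\<close>. Up to \<open>\<epsilon>\<close>, the operator \<open>a\<close> carries this inner product to the original
  one and maps the ranges of \<open>p\<close> and \<open>q\<close> onto themselves. So the compression of \<open>p\<close> to the range of
  \<open>q\<close>, taken in the two inner products, has the same approximate eigenvalues \<open>\<theta>\<close>. The assumption
  \<open>below\<close> excludes \<open>\<theta>\<close> for the new inner product, the conclusion for the original one.\<close>

lemma bounded_below_transfer:
  assumes p: "p \<in> Lat M A" and q: "q \<in> Lat M A"
    and z: "z \<in> M" "z' \<in> M" and inv: "z o\<^sub>L z' = id_blinfun" "z' o\<^sub>L z = id_blinfun"
    and zp: "\<And>x y. inner (z (p x)) (z y) = inner (p x) y"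
    and \<theta>: "0 \<le> \<theta>" "\<theta> \<le> 1" and \<kappa>: "0 < \<kappa>"
    and below: "\<And>w. q w = w \<Longrightarrow> w \<noteq> 0 \<Longrightarrow>
      \<exists>u. q u = u \<and> u \<noteq> 0 \<and> \<kappa> * norm w * norm u \<le> inner (p w) u - \<theta> * inner (z w) (z u)"
  shows "\<exists>\<mu>>0. \<forall>w. q w = w \<longrightarrow> \<mu> * norm w \<le> norm (q (p w) - \<theta> *\<^sub>R w)"
proof -
  obtain C where C: "0 < C" and approx: "\<And>\<epsilon>. 0 < \<epsilon> \<Longrightarrow>
    \<exists>a\<in>A. \<exists>b\<in>A. (\<forall>x. a (b x) = x) \<and> (\<forall>x. b (a x) = x) \<and>
      (\<forall>v w. \<bar>inner (a v) (a w) - inner (z v) (z w)\<bar> \<le> \<epsilon> * norm v * norm w) \<and>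
      (\<forall>v. norm v \<le> C * norm (a v)) \<and> (\<forall>v. norm (a v) \<le> C * norm v)"
    using ex_bounded_almost_isometry[OF z inv] by blast
  define \<epsilon> where "\<epsilon> = (\<kappa> / 2) / (2 + C * C)"
  have D: "0 < 2 + C * C" using C by (simp add: add_pos_pos)
  have \<epsilon>: "0 < \<epsilon>" "\<epsilon> * (2 + C * C) = \<kappa> / 2"
    using \<kappa> D eq_divide_eq[of \<epsilon> "\<kappa> / 2" "2 + C * C"] by (simp_all add: \<epsilon>_def)
  obtain a b where ab: "a \<in> A" "b \<in> A" "\<And>x. a (b x) = x" "\<And>x. b (a x) = x"
    and err: "\<And>v w. \<bar>inner (a v) (a w) - inner (z v) (z w)\<bar> \<le> \<epsilon> * norm v * norm w"
    and lower: "\<And>v. norm v \<le> C * norm (a v)" and upper: "\<And>v. norm (a v) \<le> C * norm v"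
    using approx[OF \<epsilon>(1)] by blast
  define \<mu> where "\<mu> = \<kappa> / (2 * C * C)"
  have \<mu>: "0 < \<mu>" using \<kappa> C by (simp add: \<mu>_def)
  have pnorm: "norm (p x) \<le> norm x" "norm (x - p x) \<le> norm x" for x
    by (rule norm_symmetric_idempotent_le; rule LatD[OF p])+
  have "\<mu> * norm v \<le> norm (q (p v) - \<theta> *\<^sub>R v)" if v: "q v = v" for v
  proof (cases "v = 0")
    case False
    define w where "w = b v"
    have aw: "a w = v" by (simp add: w_def ab)
    have qw: "q w = w" using LatD(4)[OF q ab(2), of v] by (simp add: w_def v)
    have w0: "w \<noteq> 0" using aw False by auto
    obtain u where u: "q u = u" "u \<noteq> 0"
      "\<kappa> * norm w * norm u \<le> inner (p w) u - \<theta> * inner (z w) (z u)"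
      using below[OF qw w0] by blast
    have qau: "q (a u) = a u" using LatD(4)[OF q ab(1), of u] by (simp add: u)
    \<comment> \<open>The second summand is small because \<open>w - p w\<close> is orthogonal to the range of \<open>p\<close> for both
      inner products.\<close>
    have split: "p v = a (p w) + p (a (w - p w))"
      using LatD(4)[OF p ab(1), of w] by (simp add: aw blinfun.diff_right)
    have off: "norm (p (a (w - p w))) \<le> \<epsilon> * C * norm (w - p w)"
    proof (rule almost_orthogonal_image[OF err _ lower ab(3)])
      show "0 \<le> \<epsilon>" using \<epsilon>(1) by simp
      show "inner (p x) y = inner x (p y)" for x y by (rule LatD(3)[OF p])
      show "p (p x) = p x" for x by (rule LatD(2)[OF p])
      show "p (b (p x)) = b (p x)" for x by (rule LatD(4)[OF p ab(2)])
      show "inner (z (w - p w)) (z (p y)) = 0" for y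
      proof -
        have "p (w - p w) = 0" by (simp add: blinfun.diff_right LatD(2)[OF p])
        then have "inner (p y) (w - p w) = 0" by (simp add: LatD(3)[OF p])
        then show ?thesis by (simp only: inner_commute[of "z (w - p w)"] zp)
      qed
    qed
    have t1: "inner (p w) u - \<epsilon> * norm w * norm u \<le> inner (a (p w)) (a u)"
    proof -
      have "\<epsilon> * norm (p w) * norm u \<le> \<epsilon> * norm w * norm u"
        using pnorm(1) \<epsilon>(1) by (intro mult_right_mono mult_left_mono) auto
      then show ?thesis using err[of "p w" u] zp[of w u] by linarith
    qed
    have t2: "- (\<epsilon> * (C * C) * norm w * norm u) \<le> inner (p (a (w - p w))) (a u)"
    proof -
      have "\<bar>inner (p (a (w - p w))) (a u)\<bar> \<le> norm (p (a (w - p w))) * norm (a u)"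
        by (rule Cauchy_Schwarz_ineq2)
      also have "\<dots> \<le> (\<epsilon> * C * norm w) * (C * norm u)"
      proof (rule mult_mono)
        have "\<epsilon> * C * norm (w - p w) \<le> \<epsilon> * C * norm w"
          using pnorm(2) \<epsilon>(1) C by (intro mult_left_mono) auto
        then show "norm (p (a (w - p w))) \<le> \<epsilon> * C * norm w" using off by linarith
      qed (use upper \<epsilon>(1) C in auto)
      also have "\<dots> = \<epsilon> * (C * C) * norm w * norm u" by simp
      finally show ?thesis by linarith
    qed
    have t3: "\<theta> * inner v (a u) \<le> \<theta> * inner (z w) (z u) + \<epsilon> * norm w * norm u"
    proof -
      have le: "inner v (a u) \<le> inner (z w) (z u) + \<epsilon> * norm w * norm u"
        using err[of w u] by (simp add: aw)
      have "\<theta> * inner v (a u) \<le> \<theta> * inner (z w) (z u) + \<theta> * (\<epsilon> * norm w * norm u)"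
        using mult_left_mono[OF le \<theta>(1)] by (simp add: distrib_left)
      moreover have "\<theta> * (\<epsilon> * norm w * norm u) \<le> 1 * (\<epsilon> * norm w * norm u)"
        using \<theta>(2) \<epsilon>(1) by (intro mult_right_mono) auto
      ultimately show ?thesis by simp
    qed
    have "inner (q (p v) - \<theta> *\<^sub>R v) (a u) = inner (p v) (a u) - \<theta> * inner v (a u)"
      by (simp add: inner_diff_left LatD(3)[OF q] qau)
    also have "inner (p v) (a u) = inner (a (p w)) (a u) + inner (p (a (w - p w))) (a u)"
      by (simp only: split inner_add_left)
    also have "\<dots> - \<theta> * inner v (a u) \<ge> \<kappa> * norm w * norm u - \<epsilon> * (2 + C * C) * norm w * norm u"
      using t1 t2 t3 u(3) by (simp add: algebra_simps)
    finally have "\<kappa> / 2 * norm w * norm u \<le> inner (q (p v) - \<theta> *\<^sub>R v) (a u)"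
      unfolding \<epsilon>(2) by (simp add: mult_ac)
    also have "\<dots> \<le> norm (q (p v) - \<theta> *\<^sub>R v) * norm (a u)" by (rule norm_cauchy_schwarz)
    also have "\<dots> \<le> norm (q (p v) - \<theta> *\<^sub>R v) * (C * norm u)"
      using upper by (intro mult_left_mono) auto
    finally have "(\<kappa> / 2 * norm w) * norm u \<le> (norm (q (p v) - \<theta> *\<^sub>R v) * C) * norm u"
      by (simp add: mult_ac)
    then have w_le: "\<kappa> / 2 * norm w \<le> norm (q (p v) - \<theta> *\<^sub>R v) * C"
      by (rule mult_right_le_imp_le) (use u(2) in simp)
    have "norm v \<le> C * norm w" using upper[of w] by (simp add: aw)
    then have "\<kappa> / 2 * norm v \<le> \<kappa> / 2 * (C * norm w)"
      using \<kappa> by (intro mult_left_mono) auto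
    also have "\<dots> = C * (\<kappa> / 2 * norm w)" by simp
    also have "\<dots> \<le> C * (norm (q (p v) - \<theta> *\<^sub>R v) * C)"
      using w_le C by (intro mult_left_mono) auto
    finally have "\<kappa> / 2 * norm v \<le> C * (norm (q (p v) - \<theta> *\<^sub>R v) * C)" .
    then show ?thesis using C by (simp add: \<mu>_def field_simps)
  qed simp
  then show ?thesis using \<mu> by blast
qed

text \<open>On the range of \<open>q\<close> let \<open>S = q p q\<close>, and let \<open>K\<close> be the spectral subspace of \<open>S\<close> for the
  interval of radius \<open>\<eta> = (1 - \<theta>) / 2\<close> around \<open>\<theta>\<close>. The inner product is changed so that the
  spectrum of the compression leaves a neighbourhood of \<open>\<theta>\<close>: with \<open>e\<close> the
  projection onto the image of \<open>K\<close> under \<open>1 - p\<close> and \<open>z = 1 + e / \<theta>\<close>, the vectors of \<open>K\<close> are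
  stretched away from the range of \<open>p\<close>. This makes their angle with that range larger, while the
  complement of \<open>K\<close>, where \<open>S\<close> already has distance at least \<open>\<eta>\<close> from \<open>\<theta>\<close>, is not affected.
  The transfer lemma then shows that \<open>\<theta>\<close> was no approximate eigenvalue of \<open>S\<close> to begin with.\<close>

lemma compression_minus_scalar_bounded_below:
  assumes p: "p \<in> Lat M A" and q: "q \<in> Lat M A" and \<theta>: "0 < \<theta>" "\<theta> < 1"
  shows "\<exists>\<mu>>0. \<forall>w. q w = w \<longrightarrow> \<mu> * norm w \<le> norm (q (p w) - \<theta> *\<^sub>R w)"
proof -
  note psym = LatD(3)[OF p] and pidem = LatD(2)[OF p]
  note qsym = LatD(3)[OF q] and qidem = LatD(2)[OF q]
  have pM: "p \<in> M" and qM: "q \<in> M" using LatD(1) p q by auto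
  define \<eta> where "\<eta> = (1 - \<theta>) / 2"
  have \<eta>: "0 < \<eta>" "\<eta> \<le> 1" "1 - \<theta> = 2 * \<eta>" using \<theta> by (auto simp: \<eta>_def)
  \<comment> \<open>The operator \<open>(S - \<theta>) / \<eta>\<close>, whose nonexpansive part is the spectral subspace for the
    interval of radius \<open>\<eta>\<close> around \<open>\<theta>\<close>.\<close>
  define f where "f v = (1 / \<eta>) *\<^sub>R (q (p (q v)) - \<theta> *\<^sub>R v)" for v
  have qpq: "q (p (q v)) = \<eta> *\<^sub>R f v + \<theta> *\<^sub>R v" for v
    using \<eta>(1) by (simp add: f_def)
  interpret f: symmetric_map f
  proof (rule symmetric_map.intro)
    show "bounded_linear f"
      unfolding f_def
      by (intro bounded_linear_intros)
    show "inner (f x) y = inner x (f y)" for x y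
      by (simp add: f_def inner_diff_left inner_diff_right psym qsym)
  qed
  interpret flin: bounded_linear f by (rule f.bounded_linear)
  define N where "N = nonexpansive_part f"
  have N_inv: "T v \<in> N"
    if T: "bounded_linear T" "\<And>x. T (p x) = p (T x)" "\<And>x. T (q x) = q (T x)" and "v \<in> N" for T v
  proof -
    interpret T: bounded_linear T by (rule T(1))
    have "T (f x) = f (T x)" for x by (simp add: f_def T.scaleR T.diff T(2,3))
    then show ?thesis
      using f.nonexpansive_part_invariant[of T v, OF T(1)] \<open>v \<in> N\<close> unfolding N_def by blast
  qed
  have comm_p: "T (p x) = p (T x)" and comm_q: "T (q x) = q (T x)"
    if "T \<in> commutant M" for T x
    using commutant_applyD[OF that] pM qM by auto
  have N_comm: "T v \<in> N" if "T \<in> commutant M" "v \<in> N" for T v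
    by (rule N_inv[of "blinfun_apply T"])
      (use that comm_p comm_q in \<open>auto simp: blinfun.bounded_linear_right\<close>)
  have N_scaleC: "c *\<^sub>C v \<in> N" if "v \<in> N" for c v
    by (rule N_inv[OF bounded_linear_scaleC])
      (use that bounded_opsD[OF M_bounded_ops] pM qM in auto)
  have fq: "q (f v) = f (q v)" for v
    by (simp add: f_def blinfun.bilinear_simps qidem)
  have N_q: "q v \<in> N" if "v \<in> N" for v
    using f.nonexpansive_part_invariant[of "blinfun_apply q" v, OF _ fq] that
    by (simp add: N_def blinfun.bounded_linear_right)
  have N_f: "f v \<in> N" if "v \<in> N" for v
    using f.nonexpansive_part_invariant[of f v, OF f.bounded_linear refl] that by (simp add: N_def)
  have N_le: "norm (f v) \<le> norm v" if "v \<in> N" for v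
    using that[unfolded N_def nonexpansive_part_def] by (auto dest: spec[of _ 1])
  have N_sub: "subspace N" unfolding N_def by (rule f.subspace_nonexpansive_part)
  have N_closed: "closed N" unfolding N_def by (rule f.closed_nonexpansive_part)
  obtain k where k: "orth_proj_onto k N" using ex_orth_proj_onto[OF N_closed N_sub] by blast
  have kq: "k (q x) = q (k x)" for x
    by (rule orth_proj_commutes[OF k qsym]) (auto simp: N_q)
  define K where "K = N \<inter> {v. q v = v}"
  define g where "g v = v - p v" for v
  have g_bl: "bounded_linear g" unfolding g_def by (intro bounded_linear_intros)
  have g_below: "\<eta> * norm v \<le> norm (g v)" if v: "v \<in> K" for v
  proof (rule power2_le_imp_le)
    have qv: "q v = v" and vN: "v \<in> N" using v by (auto simp: K_def)
    have "(norm (p v))\<^sup>2 = inner (q (p (q v))) v"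
      by (simp add: qsym qv psym pidem power2_norm_eq_inner)
    also have "\<dots> = \<eta> * inner (f v) v + \<theta> * (norm v)\<^sup>2"
      unfolding qpq by (simp add: inner_add_left power2_norm_eq_inner)
    also have "\<eta> * inner (f v) v \<le> \<eta> * (norm v)\<^sup>2"
    proof (rule mult_left_mono)
      have "inner (f v) v \<le> norm (f v) * norm v" by (rule norm_cauchy_schwarz)
      also have "\<dots> \<le> norm v * norm v" using N_le[OF vN] by (rule mult_right_mono) simp
      finally show "inner (f v) v \<le> (norm v)\<^sup>2" by (simp add: power2_eq_square)
    qed (use \<eta> in simp)
    finally have "(norm (p v))\<^sup>2 \<le> (\<eta> + \<theta>) * (norm v)\<^sup>2" by (simp add: distrib_right)
    also have "\<eta> + \<theta> = 1 - \<eta>" using \<eta>(3) by simp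
    finally have "(norm (p v))\<^sup>2 \<le> (1 - \<eta>) * (norm v)\<^sup>2" .
    then have "\<eta> * (norm v)\<^sup>2 \<le> (norm (g v))\<^sup>2"
      unfolding g_def norm_symmetric_idempotent_le(3)[of "blinfun_apply p", OF psym pidem]
      by (simp add: algebra_simps)
    moreover have "\<eta>\<^sup>2 \<le> \<eta>" using \<eta> by (simp add: power2_eq_square mult_left_le)
    then have "\<eta>\<^sup>2 * (norm v)\<^sup>2 \<le> \<eta> * (norm v)\<^sup>2" by (rule mult_right_mono) simp
    ultimately show "(\<eta> * norm v)\<^sup>2 \<le> (norm (g v))\<^sup>2" by (simp add: power_mult_distrib)
  qed simp
  have K_sub: "subspace K"
    unfolding K_def
    using N_sub by (auto simp: subspace_def blinfun.bilinear_simps)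
  have K_closed: "closed K"
    unfolding K_def by (intro closed_Int N_closed closed_Collect_eq continuous_intros)
  define L where "L = g ` K"
  have "complete L"
    unfolding L_def
    by (rule complete_isometric_image[OF \<eta>(1) K_sub g_bl])
      (use g_below K_closed in \<open>auto simp: complete_eq_closed\<close>)
  then have L_closed: "closed L" by (rule complete_imp_closed)
  have L_sub: "subspace L"
    unfolding L_def by (rule linear_subspace_image[OF bounded_linear.linear[OF g_bl] K_sub])
  obtain e where e: "orth_proj_onto e L" using ex_orth_proj_onto[OF L_closed L_sub] by blast
  note esym = orth_proj_ontoD(4)[OF e] and eidem = orth_proj_ontoD(3)[OF e]
  have eM: "e \<in> M"
  proof (rule orth_proj_in_von_neumann_algebra[OF von_neumann e])
    show "c *\<^sub>C x \<in> L" if "x \<in> L" for c x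
    proof -
      obtain v where v: "v \<in> K" "x = g v" using \<open>x \<in> L\<close> by (auto simp: L_def)
      have "c *\<^sub>C v \<in> K"
        using v N_scaleC bounded_opsD[OF M_bounded_ops[OF qM]] by (simp add: K_def)
      moreover have "c *\<^sub>C x = g (c *\<^sub>C v)"
        by (simp add: v g_def linear_diff[OF bounded_linear.linear[OF bounded_linear_scaleC]]
            bounded_opsD[OF M_bounded_ops[OF pM]])
      ultimately show ?thesis by (simp add: L_def)
    qed
    show "T x \<in> L" if T: "T \<in> commutant M" and "x \<in> L" for T x
    proof -
      obtain v where v: "v \<in> K" "x = g v" using \<open>x \<in> L\<close> by (auto simp: L_def)
      have "T v \<in> K" using v N_comm[OF T] comm_q[OF T, of v] by (simp add: K_def)
      moreover have "T x = g (T v)" by (simp add: v g_def blinfun.diff_right comm_p[OF T])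
      ultimately show ?thesis by (simp add: L_def)
    qed
  qed
  have e_range: "\<exists>v\<in>K. e x = v - p v" for x
    using orth_proj_ontoD(1)[OF e, of x] by (auto simp: L_def g_def)
  have pe: "p (e x) = 0" for x
    using e_range[of x] by (auto simp: blinfun.diff_right pidem)
  have ep: "e (p x) = 0" for x
    by (rule inner_eqI) (simp add: esym psym pe)
  have e_in: "e w = w - p w" if "w \<in> K" for w
  proof -
    have "e (w - p w) = w - p w"
      by (rule orth_proj_ontoD(2)[OF e]) (use that in \<open>auto simp: L_def g_def\<close>)
    then show ?thesis by (simp add: blinfun.diff_right ep)
  qed
  have e_out: "e w = 0" if qw: "q w = w" and orth: "\<And>v. v \<in> N \<Longrightarrow> inner w v = 0" for w
  proof (rule inner_eqI)
    fix y
    obtain v where v: "v \<in> K" "e y = v - p v" using e_range by blast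
    then have "v \<in> N" "q v = v" by (auto simp: K_def)
    have "inner w (p v) = inner (q w) (p (q v))" by (simp add: qw \<open>q v = v\<close>)
    also have "\<dots> = inner w (\<eta> *\<^sub>R f v + \<theta> *\<^sub>R v)" by (simp add: qsym qpq)
    also have "\<dots> = 0" using orth N_f \<open>v \<in> N\<close> by (simp add: inner_add_right)
    finally show "inner (e w) y = inner 0 y"
      using orth[OF \<open>v \<in> N\<close>] by (simp add: esym v inner_diff_right)
  qed
  \<comment> \<open>This choice gives \<open>\<theta> (2 \<sigma> + \<sigma>\<^sup>2) = 2 + \<sigma>\<close>, large enough to push the form on \<open>K\<close> below \<open>-\<eta>\<close>.\<close>
  define \<sigma> where "\<sigma> = 1 / \<theta>"
  have \<sigma>: "0 < \<sigma>" "\<theta> * \<sigma> = 1" using \<theta> by (auto simp: \<sigma>_def)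
  define \<tau> where "\<tau> = \<sigma> / (1 + \<sigma>)"
  have \<tau>: "\<sigma> - \<tau> - \<sigma> * \<tau> = 0" using \<sigma>(1) by (simp add: \<tau>_def field_simps)
  define z where "z = id_blinfun + \<sigma> *\<^sub>R e"
  define z' where "z' = id_blinfun - \<tau> *\<^sub>R e"
  have z_app: "z x = x + \<sigma> *\<^sub>R e x" for x by (simp add: z_def blinfun.bilinear_simps)
  have z'_app: "z' x = x - \<tau> *\<^sub>R e x" for x
    by (simp add: z'_def blinfun.bilinear_simps)
  have zM: "z \<in> M" "z' \<in> M"
    unfolding z_def z'_def
    using eM unital_subalgebraD(2)[OF unital_M] unital_subalgebra_scaleR[OF unital_M]
      unital_subalgebraD(3)[OF unital_M] unital_subalgebra_diff[OF unital_M] by auto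
  have "z (z' x) = x + (\<sigma> - \<tau> - \<sigma> * \<tau>) *\<^sub>R e x" for x
    by (simp add: z_app z'_app blinfun.bilinear_simps eidem algebra_simps)
  moreover have "z' (z x) = x + (\<sigma> - \<tau> - \<sigma> * \<tau>) *\<^sub>R e x" for x
    by (simp add: z_app z'_app blinfun.bilinear_simps eidem algebra_simps)
  ultimately have inv: "z o\<^sub>L z' = id_blinfun" "z' o\<^sub>L z = id_blinfun"
    unfolding \<tau> by (auto intro!: blinfun_eqI)
  have z_form: "inner (z x) (z y) = inner x y + (2 * \<sigma> + \<sigma> * \<sigma>) * inner (e x) y" for x y
  proof -
    have "inner (e x) (e y) = inner (e x) y" "inner x (e y) = inner (e x) y"
      by (metis esym eidem)+
    then show ?thesis
      by (simp add: z_app inner_add_left inner_add_right algebra_simps)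
  qed
  show ?thesis
  proof (rule bounded_below_transfer[where z = z and \<kappa> = \<eta>, OF p q zM inv])
    show "0 < \<eta>" by (rule \<eta>(1))
    show "inner (z (p x)) (z y) = inner (p x) y" for x y by (simp add: z_form ep)
    show "0 \<le> \<theta>" "\<theta> \<le> 1" using \<theta> by auto
    fix w assume qw: "q w = w" and w0: "w \<noteq> 0"
    define w1 where "w1 = k w"
    define w2 where "w2 = w - w1"
    have w: "w = w1 + w2" by (simp add: w2_def)
    have w1N: "w1 \<in> N" using orth_proj_ontoD(1)[OF k] by (simp add: w1_def)
    have w1q: "q w1 = w1" using kq[of w] by (simp add: w1_def qw)
    have w2q: "q w2 = w2" by (simp add: w2_def blinfun.diff_right qw w1q)
    have w2_orth: "inner w2 v = 0" if "v \<in> N" for v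
      using orth_proj_ontoD(5)[OF k that] by (simp add: w2_def w1_def)
    have ew: "e w = w1 - p w1"
      using e_in[of w1] e_out[OF w2q w2_orth] w1N w1q by (simp add: w blinfun.add_right K_def)
    \<comment> \<open>The form of the compression minus \<open>\<theta>\<close> in the new inner product is represented at \<open>w\<close> by
      the vector \<open>u\<close>, in the original inner product. The two summands of \<open>u\<close> belong to the nonexpansive part of \<open>f\<close> and its orthogonal complement.\<close>
    define x1 where "x1 = (3 + \<sigma>) *\<^sub>R f w1 - (4 + 2 * \<sigma>) *\<^sub>R w1"
    define u where "u = \<eta> *\<^sub>R (x1 + f w2)"
    have x1N: "x1 \<in> N"
      unfolding x1_def by (intro subspace_diff subspace_scale N_sub N_f w1N)
    have qf: "q (f v) = f v" if "q v = v" for v using fq[of v] that by simp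
    have qu: "q u = u"
      by (simp add: u_def x1_def blinfun.bilinear_simps qf w1q w2q)
    have form: "inner (p w) y - \<theta> * inner (z w) (z y) = inner u y" if qy: "q y = y" for y
    proof -
      have pq: "inner (p v) y = inner (\<eta> *\<^sub>R f v + \<theta> *\<^sub>R v) y" if "q v = v" for v
      proof -
        have "inner (p v) y = inner (q (p (q v))) y" by (simp add: qsym qy that)
        then show ?thesis by (simp only: qpq)
      qed
      have "inner (p w) y - \<theta> * inner (z w) (z y) =
          inner (p w) y - \<theta> * inner w y - (\<theta> * \<sigma>) * (2 + \<sigma>) * inner (w1 - p w1) y"
        by (simp add: z_form ew algebra_simps)
      also have "\<dots> = \<eta> * inner (f w) y - (2 + \<sigma>) * ((1 - \<theta>) * inner w1 y - \<eta> * inner (f w1) y)"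
        unfolding \<sigma>(2) by (simp add: inner_diff_left pq[OF qw] pq[OF w1q] inner_add_left algebra_simps)
      also have "\<dots> = inner u y"
        unfolding \<eta>(3) by (simp add: u_def x1_def w flin.add inner_add_left inner_diff_left algebra_simps)
      finally show ?thesis .
    qed
    have "norm w1 \<le> norm x1"
    proof -
      have "(4 + 2 * \<sigma>) * norm w1 - (3 + \<sigma>) * norm (f w1) \<le> norm x1"
        using norm_triangle_ineq2[of "(4 + 2 * \<sigma>) *\<^sub>R w1" "(3 + \<sigma>) *\<^sub>R f w1"] \<sigma>(1)
        by (simp add: x1_def norm_minus_commute)
      moreover have "(3 + \<sigma>) * norm (f w1) \<le> (3 + \<sigma>) * norm w1"
        using N_le[OF w1N] \<sigma>(1) by (intro mult_left_mono) auto
      moreover have "0 \<le> \<sigma> * norm w1" using \<sigma>(1) by simp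
      ultimately show ?thesis by (simp add: algebra_simps)
    qed
    moreover have "norm w2 \<le> norm (f w2)"
      by (rule f.norm_le_on_orthogonal_complement) (simp add: w2_orth N_def[symmetric])
    moreover have "inner x1 (f w2) = 0"
      using w2_orth[OF N_f[OF x1N]] by (simp only: f.symmetric[symmetric] inner_commute[of "f x1"])
    moreover have "inner w1 w2 = 0" using w2_orth[OF w1N] by (simp add: inner_commute)
    moreover have "(norm (x + y))\<^sup>2 = (norm x)\<^sup>2 + (norm y)\<^sup>2" if "inner x y = 0" for x y :: 'a
      using that by (simp add: power2_norm_eq_inner inner_add_left inner_add_right inner_commute[of y x])
    ultimately have "(norm w)\<^sup>2 \<le> (norm (x1 + f w2))\<^sup>2"
      unfolding w by (simp add: add_mono power_mono)
    then have "norm w \<le> norm (x1 + f w2)" by (rule power2_le_imp_le) simp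
    then have u_ge: "\<eta> * norm w \<le> norm u" using \<eta>(1) by (simp add: u_def)
    have "u \<noteq> 0" using u_ge w0 \<eta>(1) by (auto simp: mult_le_0_iff)
    moreover have "\<eta> * norm w * norm u \<le> inner (p w) u - \<theta> * inner (z w) (z u)"
      unfolding form[OF qu] power2_norm_eq_inner[symmetric] power2_eq_square
      using u_ge by (rule mult_right_mono) simp
    ultimately show "\<exists>u. q u = u \<and> u \<noteq> 0 \<and>
        \<eta> * norm w * norm u \<le> inner (p w) u - \<theta> * inner (z w) (z u)"
      using qu by blast
  qed
qed

end

section \<open>Commutation\<close>

text \<open>For a positive operator, \<open>N\<^sup>2 \<le> norm N * N\<close>; the form is evaluated at
  \<open>v - N v / norm N\<close>.\<close>

lemma norm_positive_apply_le:
  fixes N :: "'a :: real_inner \<Rightarrow>\<^sub>L 'a"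
  assumes sym: "\<And>x y. inner (N x) y = inner x (N y)" and pos: "\<And>x. 0 \<le> inner (N x) x"
  shows "(norm (N v))\<^sup>2 \<le> norm N * inner (N v) v"
proof (cases "norm N = 0")
  case False
  define m where "m = norm N"
  have m: "0 < m" using False by (simp add: m_def)
  define t where "t = 1 / m"
  have t: "t * m = 1" "0 < t" using m by (auto simp: t_def)
  have NNv: "inner (N (N v)) (N v) \<le> m * (norm (N v))\<^sup>2"
  proof -
    have "inner (N (N v)) (N v) \<le> norm (N (N v)) * norm (N v)" by (rule norm_cauchy_schwarz)
    also have "\<dots> \<le> m * norm (N v) * norm (N v)"
      unfolding m_def by (intro mult_right_mono norm_blinfun) simp
    finally show ?thesis by (simp add: power2_eq_square)
  qed
  have "0 \<le> inner (N (v - t *\<^sub>R N v)) (v - t *\<^sub>R N v)" by (rule pos)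
  also have "\<dots> = inner (N v) v - 2 * t * (norm (N v))\<^sup>2 + t * (t * inner (N (N v)) (N v))"
    using sym[of "N v" v]
    by (simp add: blinfun.bilinear_simps inner_diff_left inner_diff_right power2_norm_eq_inner
        algebra_simps)
  also have "\<dots> \<le> inner (N v) v - 2 * t * (norm (N v))\<^sup>2 + t * (t * (m * (norm (N v))\<^sup>2))"
    using NNv t(2) by (intro add_left_mono mult_left_mono) auto
  also have "t * (t * (m * (norm (N v))\<^sup>2)) = t * ((t * m) * (norm (N v))\<^sup>2)" by (simp only: mult_ac)
  finally have "t * (norm (N v))\<^sup>2 \<le> inner (N v) v" unfolding t(1) by simp
  then have "m * (t * (norm (N v))\<^sup>2) \<le> m * inner (N v) v" using m by (intro mult_left_mono) auto
  moreover have "m * (t * (norm (N v))\<^sup>2) = (t * m) * (norm (N v))\<^sup>2" by (simp only: mult_ac)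
  ultimately have "(norm (N v))\<^sup>2 \<le> m * inner (N v) v" unfolding t(1) by simp
  then show ?thesis unfolding m_def .
qed simp

text \<open>Let \<open>S = q p q\<close> and \<open>N = S - S\<^sup>2 \<ge> 0\<close>. The norm \<open>m\<close> of the positive operator \<open>N\<close> is an
  approximate eigenvalue of \<open>N\<close>, and \<open>m \<le> 1 / 4\<close>. If \<open>m > 0\<close>, then \<open>m - N\<close> factors as
  \<open>(S - \<alpha>) (S - \<beta>)\<close> with \<open>\<alpha>, \<beta>\<close> strictly between \<open>0\<close> and \<open>1\<close>, so one of the factors is not bounded
  below on the range of \<open>q\<close>. Hence \<open>N = 0\<close>, so \<open>p q = q p q\<close> is symmetric.\<close>

lemma projections_commute_if_no_intermediate_spectrum:
  fixes p q :: "'a :: real_inner \<Rightarrow>\<^sub>L 'a"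
  assumes psym: "\<And>x y. inner (p x) y = inner x (p y)" and pidem: "\<And>x. p (p x) = p x"
    and qsym: "\<And>x y. inner (q x) y = inner x (q y)" and qidem: "\<And>x. q (q x) = q x"
    and below: "\<And>\<theta>. 0 < \<theta> \<Longrightarrow> \<theta> < 1 \<Longrightarrow>
      \<exists>\<mu>>0. \<forall>w. q w = w \<longrightarrow> \<mu> * norm w \<le> norm (q (p w) - \<theta> *\<^sub>R w)"
  shows "p o\<^sub>L q = q o\<^sub>L p"
proof -
  define S where "S = q o\<^sub>L p o\<^sub>L q"
  define N where "N = S - (S o\<^sub>L S)"
  define m where "m = norm N"
  have S: "S x = q (p (q x))" for x by (simp add: S_def)
  have N: "N x = S x - S (S x)" for x by (simp add: N_def blinfun.diff_left)
  have Ssym: "inner (S x) y = inner x (S y)" for x y by (simp add: S psym qsym)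
  have Nsym: "inner (N x) y = inner x (N y)" for x y
    by (simp add: N inner_diff_left inner_diff_right Ssym)
  note pq_norm = norm_symmetric_idempotent_le[of "blinfun_apply p", OF psym pidem]
    norm_symmetric_idempotent_le[of "blinfun_apply q", OF qsym qidem]
  have Sform: "inner (S x) x = (norm (p (q x)))\<^sup>2" for x
  proof -
    have "inner (S x) x = inner (p (q x)) (q x)" by (simp only: S qsym)
    also have "\<dots> = inner (p (p (q x))) (q x)" by (simp only: pidem)
    also have "\<dots> = inner (p (q x)) (p (q x))" by (simp only: psym)
    finally show ?thesis by (simp only: power2_norm_eq_inner)
  qed
  have Nform: "inner (N x) x = (norm (p (q x)))\<^sup>2 - (norm (S x))\<^sup>2" for x
    using Ssym[of "S x" x] by (simp add: N inner_diff_left Sform power2_norm_eq_inner)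
  have Npos: "0 \<le> inner (N x) x" for x
    unfolding Nform S using power_mono[OF pq_norm(4)[of "p (q x)"], of 2] by simp
  have N_le: "(norm (N x))\<^sup>2 \<le> m * inner (N x) x" for x
    unfolding m_def by (rule norm_positive_apply_le[OF Nsym Npos])
  have m0: "0 \<le> m" by (simp add: m_def)
  have quarter: "m \<le> 1 / 4"
  proof -
    have form_le: "inner (N x) x \<le> (norm x)\<^sup>2 / 4" for x
    proof -
      have "inner (N x) x \<le> norm (S x) * norm x - (norm (S x))\<^sup>2"
        unfolding Nform Sform[symmetric] using norm_cauchy_schwarz[of "S x" x] by simp
      also have "\<dots> = (norm x)\<^sup>2 / 4 - (norm x / 2 - norm (S x))\<^sup>2"
        by (simp add: power2_eq_square algebra_simps)
      finally show ?thesis using zero_le_power2[of "norm x / 2 - norm (S x)"] by linarith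
    qed
    have "norm (N x) \<le> sqrt (m / 4) * norm x" for x
    proof (rule power2_le_imp_le)
      have "m * inner (N x) x \<le> m * ((norm x)\<^sup>2 / 4)"
        using form_le m0 by (rule mult_left_mono)
      then show "(norm (N x))\<^sup>2 \<le> (sqrt (m / 4) * norm x)\<^sup>2"
        using N_le[of x] m0 by (simp add: power_mult_distrib)
    qed (use m0 in simp)
    then have "m \<le> sqrt (m / 4)"
      unfolding m_def by (intro norm_blinfun_bound) (use m0 m_def in auto)
    then have "m\<^sup>2 \<le> (sqrt (m / 4))\<^sup>2" using m0 by (rule power_mono)
    then have "m * m \<le> m * (1 / 4)" using m0 by (simp add: power2_eq_square)
    then show ?thesis using m0 by (cases "m = 0") auto
  qed
  have "m = 0"
  proof (rule ccontr)
    assume "m \<noteq> 0"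
    then have m: "0 < m" using m0 by simp
    define d where "d = sqrt (1 - 4 * m)"
    have d: "0 \<le> d" "d\<^sup>2 = 1 - 4 * m" using quarter by (auto simp: d_def)
    have "d < 1" using d m by (intro power2_less_imp_less[of d 1]) auto
    define \<alpha> \<beta> where "\<alpha> = (1 + d) / 2" and "\<beta> = (1 - d) / 2"
    have ab: "0 < \<alpha>" "\<alpha> < 1" "0 < \<beta>" "\<beta> < 1" "\<alpha> + \<beta> = 1" "\<alpha> * \<beta> = m"
      using d \<open>d < 1\<close> by (auto simp: \<alpha>_def \<beta>_def field_simps power2_eq_square)
    obtain \<mu> where \<mu>: "0 < \<mu>" "\<And>w. q w = w \<Longrightarrow> \<mu> * norm w \<le> norm (q (p w) - \<alpha> *\<^sub>R w)"
      using below[OF ab(1,2)] by blast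
    obtain \<nu> where \<nu>: "0 < \<nu>" "\<And>w. q w = w \<Longrightarrow> \<nu> * norm w \<le> norm (q (p w) - \<beta> *\<^sub>R w)"
      using below[OF ab(3,4)] by blast
    define c where "c = (\<mu> * \<nu>)\<^sup>2"
    have c: "0 < c" using \<mu>(1) \<nu>(1) by (simp add: c_def)
    have small: "(norm (N w))\<^sup>2 \<le> (m\<^sup>2 - c) * (norm w)\<^sup>2" if w: "q w = w" for w
    proof -
      define u where "u = q (p w) - \<beta> *\<^sub>R w"
      have qu: "q u = u" by (simp add: u_def blinfun.bilinear_simps qidem w)
      have "q (p u) - \<alpha> *\<^sub>R u = S (S w) - (\<alpha> + \<beta>) *\<^sub>R S w + (\<alpha> * \<beta>) *\<^sub>R w"
        by (simp add: u_def S w qidem blinfun.bilinear_simps algebra_simps)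
      then have "q (p u) - \<alpha> *\<^sub>R u = m *\<^sub>R w - N w" unfolding ab(5,6) by (simp add: N)
      then have "\<mu> * norm u \<le> norm (m *\<^sub>R w - N w)" using \<mu>(2)[OF qu] by simp
      moreover have "\<mu> * (\<nu> * norm w) \<le> \<mu> * norm u"
        using \<nu>(2)[OF w] \<mu>(1) by (intro mult_left_mono) (auto simp: u_def)
      ultimately have "\<mu> * \<nu> * norm w \<le> norm (m *\<^sub>R w - N w)" by simp
      then have "(\<mu> * \<nu> * norm w)\<^sup>2 \<le> (norm (m *\<^sub>R w - N w))\<^sup>2"
        using \<mu>(1) \<nu>(1) by (intro power_mono) auto
      also have "\<dots> = m\<^sup>2 * (norm w)\<^sup>2 - 2 * (m * inner (N w) w) + (norm (N w))\<^sup>2"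
        by (simp add: power2_norm_eq_inner inner_diff_left inner_diff_right power2_eq_square[of m]
            inner_commute[of w "N w"] algebra_simps)
      finally show ?thesis
        using N_le[of w] by (simp add: c_def power_mult_distrib left_diff_distrib)
    qed
    \<comment> \<open>Since \<open>N x = N (q x)\<close>, the bound on the range of \<open>q\<close> contradicts that \<open>m\<close> is the norm of \<open>N\<close>.\<close>
    define r where "r = max 0 (m\<^sup>2 - c)"
    have "norm (N x) \<le> sqrt r * norm x" for x
    proof (rule power2_le_imp_le)
      have "N x = N (q x)" by (simp add: N S qidem)
      then have "(norm (N x))\<^sup>2 \<le> (m\<^sup>2 - c) * (norm (q x))\<^sup>2" using small[OF qidem, of x] by simp
      also have "\<dots> \<le> r * (norm (q x))\<^sup>2" unfolding r_def by (intro mult_right_mono) auto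
      also have "\<dots> \<le> r * (norm x)\<^sup>2"
        using pq_norm(4)[of x] by (intro mult_left_mono power_mono) (auto simp: r_def)
      finally show "(norm (N x))\<^sup>2 \<le> (sqrt r * norm x)\<^sup>2" by (simp add: power_mult_distrib r_def)
    qed (simp add: r_def)
    then have "m \<le> sqrt r" unfolding m_def by (intro norm_blinfun_bound) (auto simp: r_def)
    then have "m\<^sup>2 \<le> (sqrt r)\<^sup>2" using m0 by (rule power_mono)
    then have "m\<^sup>2 \<le> r" by (simp add: r_def)
    moreover have "0 < m\<^sup>2" using m by simp
    ultimately show False using c unfolding r_def by linarith
  qed
  then have "N = 0" by (simp add: m_def)
  then have "(norm (p (q x)))\<^sup>2 - (norm (q (p (q x))))\<^sup>2 = 0" for x
    using Nform[of x] by (simp add: S)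
  then have eq: "p (q x) = q (p (q x))" for x
    using pq_norm(6)[of "p (q x)"] by simp
  show ?thesis
  proof (rule blinfun_eqI, rule inner_eqI)
    fix x y
    have "inner (p (q x)) y = inner (q (p (q x))) y" by (simp only: eq[of x, symmetric])
    also have "\<dots> = inner x (q (p (q y)))" by (simp only: psym qsym)
    also have "\<dots> = inner x (p (q y))" by (simp only: eq[of y, symmetric])
    also have "\<dots> = inner (q (p x)) y" by (simp only: psym qsym)
    finally show "inner ((p o\<^sub>L q) x) y = inner ((q o\<^sub>L p) x) y" by simp
  qed
qed

context logmodular_subalgebra
begin

lemma Lat_commute:
  assumes p: "p \<in> Lat M A" and q: "q \<in> Lat M A"
  shows "p o\<^sub>L q = q o\<^sub>L p"
proof (rule projections_commute_if_no_intermediate_spectrum)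
  show "inner (p x) y = inner x (p y)" "p (p x) = p x"
    "inner (q x) y = inner x (q y)" "q (q x) = q x" for x y
    using LatD[OF p] LatD[OF q] by auto
  show "\<exists>\<mu>>0. \<forall>w. q w = w \<longrightarrow> \<mu> * norm w \<le> norm (q (p w) - \<theta> *\<^sub>R w)"
    if "0 < \<theta>" "\<theta> < 1" for \<theta>
    by (rule compression_minus_scalar_bounded_below[OF p q that])
qed

section \<open>Factors\<close>

lemma op_le_if_compose_eq:
  assumes p: "p \<in> Lat M A" and q: "q \<in> Lat M A" and "q o\<^sub>L p = p" "p o\<^sub>L q = p"
  shows "op_le p q"
proof -
  have qp: "q (p x) = p x" "p (q x) = p x" for x
    using assms(3,4) by (metis blinfun_apply_blinfun_compose)+
  have sym: "inner ((q - p) x) y = inner x ((q - p) y)" for x y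
    by (simp add: blinfun.diff_left inner_diff_left inner_diff_right LatD(3)[OF p] LatD(3)[OF q])
  have idem: "(q - p) ((q - p) x) = (q - p) x" for x
    by (simp add: blinfun.diff_left blinfun.diff_right qp LatD(2)[OF p] LatD(2)[OF q])
  show ?thesis
    unfolding op_le_def
  proof (rule positive_opI[OF _ sym])
    show "q - p \<in> bounded_ops"
      by (rule M_bounded_ops[OF unital_subalgebra_diff[OF unital_M LatD(1)[OF q] LatD(1)[OF p]]])
    show "0 \<le> inner x ((q - p) x)" for x
      using sym[of x "(q - p) x"] inner_ge_zero[of "(q - p) x"] unfolding idem by linarith
  qed
qed

text \<open>The hypotheses say that \<open>x\<close> maps the range of \<open>q - p q\<close> to that of \<open>p - p q\<close> and vanishes on
  the orthogonal complement of the former. For \<open>z = 1 + x\<close> and a suitable \<open>w\<close> in the range of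
  \<open>q - p q\<close>, the vectors \<open>w\<close> and \<open>v = x w\<close> satisfy \<open>\<langle>z v, z w\<rangle> = (norm v)\<^sup>2\<close>,
  whereas \<open>w\<close> is orthogonal to the range of \<open>p q\<close> in this inner product. An almost isometry \<open>a\<close> preserves the
  ranges of \<open>p\<close>, \<open>q\<close> and \<open>p q\<close>. Therefore \<open>\<langle>a v, a w\<rangle> = \<langle>a v, p q (a w)\<rangle>\<close> is almost zero, although it is
  close to \<open>(norm v)\<^sup>2\<close>.\<close>

lemma corner_between_Lat_eq_zero:
  assumes p: "p \<in> Lat M A" and q: "q \<in> Lat M A" and x: "x \<in> M"
    and px: "\<And>v. p (x v) = x v" and qx: "\<And>v. q (x v) = 0"
    and xp: "\<And>v. x (p v) = 0" and xq: "\<And>v. x (q v) = x v"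
  shows "x = 0"
proof (rule ccontr)
  assume "x \<noteq> 0"
  then obtain w0 where w0: "x w0 \<noteq> 0" using blinfun_eqI[of x 0] by auto
  note psym = LatD(3)[OF p] and pidem = LatD(2)[OF p]
  note qsym = LatD(3)[OF q] and qidem = LatD(2)[OF q]
  have pq: "p (q v) = q (p v)" for v
    using Lat_commute[OF p q] by (metis blinfun_apply_blinfun_compose)
  define w where "w = q w0 - p (q w0)"
  define v where "v = x w"
  have v: "v = x w0" by (simp add: v_def w_def blinfun.diff_right xp xq)
  have pw: "p w = 0" by (simp add: w_def blinfun.diff_right pidem)
  have qw: "q w = w" by (simp add: w_def blinfun.diff_right qidem pq[symmetric])
  have pv: "p v = v" and qv: "q v = 0" by (simp_all add: v px qx)
  have xv: "x v = 0" using xp[of v] by (simp add: pv)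
  have xx: "x (x u) = 0" for u using xp[of "x u"] by (simp add: px)
  define z where "z = id_blinfun + x"
  define z' where "z' = id_blinfun - x"
  have z_app: "z u = u + x u" and z'_app: "z' u = u - x u" for u
    by (simp_all add: z_def z'_def blinfun.bilinear_simps)
  have zM: "z \<in> M" "z' \<in> M"
    unfolding z_def z'_def
    using x unital_subalgebraD(2,3)[OF unital_M] unital_subalgebra_diff[OF unital_M] by auto
  have inv: "z o\<^sub>L z' = id_blinfun" "z' o\<^sub>L z = id_blinfun"
    by (auto intro!: blinfun_eqI simp: z_app z'_app blinfun.bilinear_simps xx)
  have vw: "inner v w = 0"
    using psym[of v w] by (simp add: pv pw)
  have zvw: "inner (z v) (z w) = (norm v)\<^sup>2"
    by (simp add: z_app xv v_def[symmetric] inner_add_right vw power2_norm_eq_inner)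
  have orth: "inner (z w) (z (p (q y))) = 0" for y
  proof -
    have "z (p (q y)) = p (q y)" by (simp add: z_app xp)
    moreover have "inner w (p (q y)) = 0" using psym[of w "q y"] by (simp add: pw)
    moreover have "inner v (p (q y)) = 0" using qsym[of v "p y"] by (simp add: pq qv)
    ultimately show ?thesis by (simp add: z_app v_def[symmetric] inner_add_left)
  qed
  obtain C where C: "0 < C" and approx: "\<And>\<epsilon>. 0 < \<epsilon> \<Longrightarrow>
    \<exists>a\<in>A. \<exists>b\<in>A. (\<forall>x. a (b x) = x) \<and> (\<forall>x. b (a x) = x) \<and>
      (\<forall>v w. \<bar>inner (a v) (a w) - inner (z v) (z w)\<bar> \<le> \<epsilon> * norm v * norm w) \<and>
      (\<forall>v. norm v \<le> C * norm (a v)) \<and> (\<forall>v. norm (a v) \<le> C * norm v)"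
    using ex_bounded_almost_isometry[OF zM inv] by blast
  \<comment> \<open>The summand \<open>1\<close> leaves the margin \<open>\<epsilon>\<close> that contradicts the estimate at the end.\<close>
  define D where "D = (1 + C * C) * norm v * norm w + 1"
  have "0 \<le> C * C" by simp
  then have D: "0 < D" unfolding D_def by (simp add: add_nonneg_pos)
  define \<epsilon> where "\<epsilon> = (norm v)\<^sup>2 / D"
  have v0: "0 < (norm v)\<^sup>2" using w0 by (simp add: v)
  then have \<epsilon>: "0 < \<epsilon>" "\<epsilon> * D = (norm v)\<^sup>2" using D by (auto simp: \<epsilon>_def)
  obtain a b where ab: "a \<in> A" "b \<in> A" "\<And>x. a (b x) = x" "\<And>x. b (a x) = x"
    and err: "\<And>v w. \<bar>inner (a v) (a w) - inner (z v) (z w)\<bar> \<le> \<epsilon> * norm v * norm w"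
    and lower: "\<And>v. norm v \<le> C * norm (a v)" and upper: "\<And>v. norm (a v) \<le> C * norm v"
    using approx[OF \<epsilon>(1)] by blast
  have "norm ((p o\<^sub>L q) (a w)) \<le> \<epsilon> * C * norm w"
  proof (rule almost_orthogonal_image[OF err _ lower ab(3)])
    show "0 \<le> \<epsilon>" using \<epsilon>(1) by simp
    show "inner ((p o\<^sub>L q) x) y = inner x ((p o\<^sub>L q) y)" for x y
      by (simp add: psym qsym pq)
    show "(p o\<^sub>L q) ((p o\<^sub>L q) x) = (p o\<^sub>L q) x" for x
      by (simp add: pq qidem pidem)
    show "(p o\<^sub>L q) (b ((p o\<^sub>L q) x)) = b ((p o\<^sub>L q) x)" for x
    proof -
      have "q (b (p (q x))) = b (p (q x))"
        using LatD(4)[OF q ab(2), of "p x"] by (simp only: pq)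
      then show ?thesis using LatD(4)[OF p ab(2), of "q x"] by simp
    qed
    show "inner (z w) (z ((p o\<^sub>L q) y)) = 0" for y using orth[of y] by simp
  qed
  then have r: "norm (p (q (a w))) \<le> \<epsilon> * C * norm w" by simp
  have "inner (a v) (a w) = inner (a v) (p (q (a w)))"
  proof -
    have "p (a v) = a v" using LatD(4)[OF p ab(1), of v] by (simp add: pv)
    moreover have "q (a w) = a w" using LatD(4)[OF q ab(1), of w] by (simp add: qw)
    ultimately show ?thesis using psym[of "a v" "a w"] by simp
  qed
  also have "\<dots> \<le> norm (a v) * norm (p (q (a w)))" by (rule norm_cauchy_schwarz)
  also have "\<dots> \<le> (C * norm v) * (\<epsilon> * C * norm w)"
    using upper r C by (intro mult_mono) auto
  finally have "(norm v)\<^sup>2 \<le> \<epsilon> * norm v * norm w + C * norm v * (\<epsilon> * C * norm w)"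
    using err[of v w] unfolding zvw by linarith
  also have "\<dots> = \<epsilon> * D - \<epsilon>" by (simp add: D_def algebra_simps)
  finally show False using \<epsilon> by linarith
qed

text \<open>If neither \<open>p \<le> q\<close> nor \<open>q \<le> p\<close>, then both \<open>p - p q\<close> and \<open>q - q p\<close> are nonzero, and a factor has a
  nonzero element in the corner between them.\<close>

lemma Lat_total_if_factor:
  assumes F: "is_factor M" and p: "p \<in> Lat M A" and q: "q \<in> Lat M A"
  shows "op_le p q \<or> op_le q p"
proof -
  have comm: "p o\<^sub>L q = q o\<^sub>L p" by (rule Lat_commute[OF p q])
  have pq: "p (q v) = q (p v)" for v using comm by (metis blinfun_apply_blinfun_compose)
  note pidem = LatD(2)[OF p] and qidem = LatD(2)[OF q]
  define e where "e = p - (p o\<^sub>L q)"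
  define f where "f = q - (q o\<^sub>L p)"
  have e_app: "e v = p v - p (q v)" and f_app: "f v = q v - q (p v)" for v
    by (simp_all add: e_def f_def blinfun.diff_left)
  have M: "e \<in> M" "f \<in> M"
    unfolding e_def f_def
    using LatD(1)[OF p] LatD(1)[OF q] unital_subalgebraD(5)[OF unital_M]
      unital_subalgebra_diff[OF unital_M] by auto
  consider "e = 0" | "f = 0" | "e \<noteq> 0" "f \<noteq> 0" by blast
  then show ?thesis
  proof cases
    case 1
    then show ?thesis using op_le_if_compose_eq[OF p q] comm by (simp add: e_def)
  next
    case 2
    then show ?thesis using op_le_if_compose_eq[OF q p] comm by (simp add: f_def)
  next
    case 3
    then obtain y where y: "y \<in> M" "e o\<^sub>L y o\<^sub>L f \<noteq> 0"
      using factor_corner_nonzero[OF F M] by blast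
    have "e o\<^sub>L y o\<^sub>L f = 0"
    proof (rule corner_between_Lat_eq_zero[OF p q])
      show "e o\<^sub>L y o\<^sub>L f \<in> M" using y(1) M unital_subalgebraD(5)[OF unital_M] by auto
      show "p ((e o\<^sub>L y o\<^sub>L f) v) = (e o\<^sub>L y o\<^sub>L f) v" for v
        by (simp add: e_app blinfun.diff_right pidem)
      show "q ((e o\<^sub>L y o\<^sub>L f) v) = 0" for v
        by (simp add: e_app blinfun.diff_right qidem pq)
      show "(e o\<^sub>L y o\<^sub>L f) (p v) = 0" for v
        by (simp add: f_app pidem)
      show "(e o\<^sub>L y o\<^sub>L f) (q v) = (e o\<^sub>L y o\<^sub>L f) v" for v
        by (simp add: f_app qidem pq)
    qed
    then show ?thesis using y(2) by simp
  qed
qed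

end

theorem theorem2p10:
  fixes M A :: "('a :: chilbert_space \<Rightarrow>\<^sub>L 'a) set"
  assumes "separable_space (euclidean :: 'a topology)"
    and "von_neumann_algebra M"
    and "unital_subalgebra A" and "A \<subseteq> M" and "closed A"
    and "logmodular M A"
  shows "(\<forall>p\<in>Lat M A. \<forall>q\<in>Lat M A. p o\<^sub>L q = q o\<^sub>L p) \<and>
         (is_factor M \<longrightarrow> (\<forall>p\<in>Lat M A. \<forall>q\<in>Lat M A. op_le p q \<or> op_le q p))"
proof -
  interpret logmodular_subalgebra M A
    using assms by (intro logmodular_subalgebra.intro)
  show ?thesis using Lat_commute Lat_total_if_factor by blast
qed

end
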